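(* Let $p\in(0,\infty)$ with $p\neq2$, let $\mathfrak N$ be a $\mathrm{II}_1$ factor, and let $\psi$ be a surjective $L^p$-isometry on $\mathscr U(\mathfrak N)$ such that $\psi(I)=I$. Then either $\psi(e^{i\theta}I)=e^{i\theta}I$ for every $\theta\in\mathbb R$, or $\psi(e^{i\theta}I)=e^{-i\theta}I$ for every $\theta\in\mathbb R$.
   Context: $\mathscr U(\mathfrak N)$ is the unitary group of $\mathfrak N$; with $\tau$ the tracial state of $\mathfrak N$, $\|A\|_p:=\tau(|A|^p)^{1/p}$. A map $\psi:\mathscr U(\mathfrak N)\to\mathscr U(\mathfrak N)$ is an $L^p$-isometry if $\|U-V\|_p=\|\psi(U)-\psi(V)\|_p$ for all $U,V\in\mathscr U(\mathfrak N)$. *)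

theory Defs
  imports "HOL-Analysis.Analysis" "HOL-Computational_Algebra.Polynomial"
begin

section \<open>Complex Hilbert spaces\<close>

text \<open>The inner product is linear in the second argument. The last axiom contains positive
  definiteness and says that the norm is the one induced by the inner product; completeness
  comes from \<^class>\<open>banach\<close>.\<close>

class chilbert_space = banach +
  fixes scaleC :: "complex \<Rightarrow> 'a \<Rightarrow> 'a" (infixr "*\<^sub>C" 75)
    and cinner :: "'a \<Rightarrow> 'a \<Rightarrow> complex"
  assumes scaleC_add_right: "c *\<^sub>C (x + y) = c *\<^sub>C x + c *\<^sub>C y"
    and scaleC_add_left: "(c + d) *\<^sub>C x = c *\<^sub>C x + d *\<^sub>C x"
    and scaleC_scaleC: "c *\<^sub>C (d *\<^sub>C x) = (c * d) *\<^sub>C x"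
    and scaleC_of_real: "complex_of_real r *\<^sub>C x = scaleR r x"
    and cinner_commute: "cinner x y = cnj (cinner y x)"
    and cinner_add_right: "cinner x (y + z) = cinner x y + cinner x z"
    and cinner_scaleC_right: "cinner x (c *\<^sub>C y) = c * cinner x y"
    and cinner_self: "cinner x x = complex_of_real ((norm x)\<^sup>2)"

instantiation complex :: chilbert_space
begin
definition scaleC_complex :: "complex \<Rightarrow> complex \<Rightarrow> complex"
  where "scaleC_complex c x = c * x"
definition cinner_complex :: "complex \<Rightarrow> complex \<Rightarrow> complex"
  where "cinner_complex x y = cnj x * y"
instance
proof
  fix x :: complex
  show "cinner x x = complex_of_real ((norm x)\<^sup>2)"
    by (simp add: cinner_complex_def complex_norm_square mult.commute del: of_real_power)
qed (auto simp: scaleC_complex_def cinner_complex_def algebra_simps scaleR_conv_of_real)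
end

lemma norm_scaleC: "norm (c *\<^sub>C x) = cmod c * norm (x :: 'h::chilbert_space)"
proof -
  have "complex_of_real ((norm (c *\<^sub>C x))\<^sup>2) = c * cinner (c *\<^sub>C x) x"
    by (simp only: cinner_self[symmetric] cinner_scaleC_right)
  also have "cinner (c *\<^sub>C x) x = cnj c * cnj (cinner x x)"
    by (subst cinner_commute) (simp add: cinner_scaleC_right)
  also have "c * (cnj c * cnj (cinner x x)) = complex_of_real ((cmod c * norm x)\<^sup>2)"
    by (simp add: cinner_self power_mult_distrib complex_norm_square[symmetric] mult.assoc[symmetric])
  finally have "(norm (c *\<^sub>C x))\<^sup>2 = (cmod c * norm x)\<^sup>2"
    by (simp only: of_real_eq_iff)
  then show ?thesis
    by (simp add: power2_eq_iff_nonneg)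
qed

lemma bounded_linear_scaleC: "bounded_linear (scaleC c :: 'h::chilbert_space \<Rightarrow> 'h)"
proof (rule bounded_linear_intro[where K = "cmod c"])
  fix r and x :: 'h
  show "c *\<^sub>C (r *\<^sub>R x) = r *\<^sub>R (c *\<^sub>C x)"
    by (simp add: scaleC_of_real[symmetric] scaleC_scaleC mult.commute)
qed (simp_all add: scaleC_add_right norm_scaleC mult.commute)


section \<open>Bounded operators\<close>

text \<open>\<^typ>\<open>'h \<Rightarrow>\<^sub>L 'h\<close> consists of the bounded real-linear maps; \<open>bounded_ops\<close>
  is the algebra B(H) of the complex-linear ones.\<close>

definition bounded_ops :: "('h::chilbert_space \<Rightarrow>\<^sub>L 'h) set"
  where "bounded_ops = {T. \<forall>c x. blinfun_apply T (c *\<^sub>C x) = c *\<^sub>C blinfun_apply T x}"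

definition scalar_op :: "complex \<Rightarrow> 'h::chilbert_space \<Rightarrow>\<^sub>L 'h"
  where "scalar_op c = Blinfun (scaleC c)"

lemma scalar_op_apply: "blinfun_apply (scalar_op c) x = c *\<^sub>C x"
  by (simp add: scalar_op_def bounded_linear_Blinfun_apply[OF bounded_linear_scaleC])

definition adj :: "('h::chilbert_space \<Rightarrow>\<^sub>L 'h) \<Rightarrow> 'h \<Rightarrow>\<^sub>L 'h"
  where "adj T = (THE S. \<forall>x y. cinner (blinfun_apply S x) y = cinner x (blinfun_apply T y))"

definition spectrum :: "('h::chilbert_space \<Rightarrow>\<^sub>L 'h) \<Rightarrow> complex set"
  where "spectrum T = {z. \<not> (\<exists>S\<in>bounded_ops.
           S o\<^sub>L (T - scalar_op z) = id_blinfun \<and> (T - scalar_op z) o\<^sub>L S = id_blinfun)}"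

definition op_poly :: "real poly \<Rightarrow> ('h::chilbert_space \<Rightarrow>\<^sub>L 'h) \<Rightarrow> 'h \<Rightarrow>\<^sub>L 'h"
  where "op_poly q T = (\<Sum>i\<le>degree q. coeff q i *\<^sub>R ((\<lambda>S. T o\<^sub>L S) ^^ i) id_blinfun)"

text \<open>Continuous functional calculus for a self-adjoint operator T (whose spectrum is real) and a
  real function f that is continuous on the spectrum: f(T) is the norm limit of q(T) as the
  polynomials q tend to f uniformly on the spectrum.\<close>

definition fun_calc :: "(real \<Rightarrow> real) \<Rightarrow> ('h::chilbert_space \<Rightarrow>\<^sub>L 'h) \<Rightarrow> 'h \<Rightarrow>\<^sub>L 'h"
  where "fun_calc f T = (THE S. \<forall>\<epsilon>>0. \<exists>q.
           (\<forall>t. complex_of_real t \<in> spectrum T \<longrightarrow> \<bar>poly q t - f t\<bar> < \<epsilon>) \<and>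
           norm (op_poly q T - S) < \<epsilon>)"

definition op_abs :: "('h::chilbert_space \<Rightarrow>\<^sub>L 'h) \<Rightarrow> 'h \<Rightarrow>\<^sub>L 'h"
  where "op_abs A = fun_calc sqrt (adj A o\<^sub>L A)"

text \<open>Real powers of a positive operator; since \<open>0 powr p = 0\<close>, the function is continuous on
  the nonnegative half-line for \<open>p > 0\<close>.\<close>

definition op_powr :: "('h::chilbert_space \<Rightarrow>\<^sub>L 'h) \<Rightarrow> real \<Rightarrow> 'h \<Rightarrow>\<^sub>L 'h"
  where "op_powr T p = fun_calc (\<lambda>t. t powr p) T"


section \<open>Factors of type II\<open>\<^sub>1\<close> and their trace\<close>

definition commutant :: "('h::chilbert_space \<Rightarrow>\<^sub>L 'h) set \<Rightarrow> ('h \<Rightarrow>\<^sub>L 'h) set"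
  where "commutant N = {T \<in> bounded_ops. \<forall>A\<in>N. T o\<^sub>L A = A o\<^sub>L T}"

definition von_neumann_algebra :: "('h::chilbert_space \<Rightarrow>\<^sub>L 'h) set \<Rightarrow> bool"
  where "von_neumann_algebra N \<longleftrightarrow>
           N \<subseteq> bounded_ops \<and> (\<forall>A\<in>N. adj A \<in> N) \<and> commutant (commutant N) = N"

definition factor :: "('h::chilbert_space \<Rightarrow>\<^sub>L 'h) set \<Rightarrow> bool"
  where "factor N \<longleftrightarrow> von_neumann_algebra N \<and> (id_blinfun :: 'h \<Rightarrow>\<^sub>L 'h) \<noteq> 0 \<and>
           N \<inter> commutant N = range scalar_op"

definition projections :: "('h::chilbert_space \<Rightarrow>\<^sub>L 'h) set \<Rightarrow> ('h \<Rightarrow>\<^sub>L 'h) set"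
  where "projections N = {P \<in> N. P o\<^sub>L P = P \<and> adj P = P}"

definition minimal_projection :: "('h::chilbert_space \<Rightarrow>\<^sub>L 'h) set \<Rightarrow> ('h \<Rightarrow>\<^sub>L 'h) \<Rightarrow> bool"
  where "minimal_projection N P \<longleftrightarrow> P \<in> projections N \<and> P \<noteq> 0 \<and>
           (\<forall>Q\<in>projections N. P o\<^sub>L Q = Q \<longrightarrow> Q = 0 \<or> Q = P)"

text \<open>The identity is a finite projection of N: it is not Murray--von Neumann equivalent in N
  to a proper subprojection, i.e. every isometry in N is unitary.\<close>

definition finite_algebra :: "('h::chilbert_space \<Rightarrow>\<^sub>L 'h) set \<Rightarrow> bool"
  where "finite_algebra N \<longleftrightarrow>
           (\<forall>V\<in>N. adj V o\<^sub>L V = id_blinfun \<longrightarrow> V o\<^sub>L adj V = id_blinfun)"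

definition II1_factor :: "('h::chilbert_space \<Rightarrow>\<^sub>L 'h) set \<Rightarrow> bool"
  where "II1_factor N \<longleftrightarrow>
           factor N \<and> finite_algebra N \<and> \<not> (\<exists>P. minimal_projection N P)"

text \<open>Only the values of \<open>\<tau>\<close> on N matter. A factor of type II\<open>\<^sub>1\<close> has exactly one tracial state;
  it is faithful (and normal), so on such a factor the following predicate determines
  \<open>\<tau>\<close> on N.\<close>

definition faithful_tracial_state ::
    "('h::chilbert_space \<Rightarrow>\<^sub>L 'h) set \<Rightarrow> (('h \<Rightarrow>\<^sub>L 'h) \<Rightarrow> complex) \<Rightarrow> bool"
  where "faithful_tracial_state N \<tau> \<longleftrightarrow>
           (\<forall>A\<in>N. \<forall>B\<in>N. \<tau> (A + B) = \<tau> A + \<tau> B) \<and>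
           (\<forall>c. \<forall>A\<in>N. \<tau> (scalar_op c o\<^sub>L A) = c * \<tau> A) \<and>
           (\<forall>A\<in>N. \<tau> (adj A o\<^sub>L A) \<in> \<real> \<and> 0 \<le> Re (\<tau> (adj A o\<^sub>L A))) \<and>
           \<tau> id_blinfun = 1 \<and>
           (\<forall>A\<in>N. \<forall>B\<in>N. \<tau> (A o\<^sub>L B) = \<tau> (B o\<^sub>L A)) \<and>
           (\<forall>A\<in>N. \<tau> (adj A o\<^sub>L A) = 0 \<longrightarrow> A = 0)"

definition Lp_norm ::
    "(('h::chilbert_space \<Rightarrow>\<^sub>L 'h) \<Rightarrow> complex) \<Rightarrow> real \<Rightarrow> ('h \<Rightarrow>\<^sub>L 'h) \<Rightarrow> real"
  where "Lp_norm \<tau> p A = Re (\<tau> (op_powr (op_abs A) p)) powr (1 / p)"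

definition unitary_group :: "('h::chilbert_space \<Rightarrow>\<^sub>L 'h) set \<Rightarrow> ('h \<Rightarrow>\<^sub>L 'h) set"
  where "unitary_group N =
           {U \<in> N. adj U o\<^sub>L U = id_blinfun \<and> U o\<^sub>L adj U = id_blinfun}"

definition Lp_isometry ::
    "(('h::chilbert_space \<Rightarrow>\<^sub>L 'h) \<Rightarrow> complex) \<Rightarrow> real \<Rightarrow> ('h \<Rightarrow>\<^sub>L 'h) set
      \<Rightarrow> (('h \<Rightarrow>\<^sub>L 'h) \<Rightarrow> ('h \<Rightarrow>\<^sub>L 'h)) \<Rightarrow> bool"
  where "Lp_isometry \<tau> p N \<psi> \<longleftrightarrow>
           \<psi> ` unitary_group N \<subseteq> unitary_group N \<and>
           (\<forall>U\<in>unitary_group N. \<forall>V\<in>unitary_group N.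
              Lp_norm \<tau> p (U - V) = Lp_norm \<tau> p (\<psi> U - \<psi> V))"

end

theory Submission
  imports Defs "HOL-Computational_Algebra.Fundamental_Theorem_Algebra"
begin

text \<open>For unitaries \<open>U, V\<close> put \<open>T = |U - V|\<^sup>2\<close>, so that \<open>|U + V|\<^sup>2 = 4 - T\<close> and
  \<open>\<parallel>U \<mp> V\<parallel>\<^sub>p\<close> are the integrals of \<open>t\<^sup>q\<close> and \<open>(4 - t)\<^sup>q\<close>, \<open>q = p/2 \<noteq> 1\<close>, against the spectral
  distribution of \<open>T\<close> (up to a power). By strict convexity or concavity these two integrals take the
  values of a point mass only at that point mass; hence \<open>\<psi>\<close> commutes with \<open>U \<mapsto> -U\<close> and preserves every
  relation \<open>U\<^sup>*V + V\<^sup>*U = c\<close> with \<open>c\<close> real. Likewise the sum of the two integrals is \<open>4\<^sup>q\<close> precisely if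
  \<open>T(4 - T) = 0\<close>, which for skew-adjoint unitaries means \<open>UV = VU\<close>. So \<open>\<psi>(i)\<close> is a skew-adjoint
  unitary commuting with all skew-adjoint unitaries of the factor, and therefore \<open>\<psi>(i) = \<plusminus>i\<close>.
  The relations of \<open>e\<^sup>i\<^sup>\<theta>\<close> with \<open>1\<close> and with \<open>i\<close> then give the real and the imaginary part of
  \<open>\<psi>(e\<^sup>i\<^sup>\<theta>)\<close>.\<close>

section \<open>Hilbert space geometry\<close>

lemma cinner_add_left: "cinner (x + y) z = cinner x z + cinner y z"
  for x y z :: "'h::chilbert_space"
  by (metis cinner_add_right cinner_commute complex_cnj_add)

lemma cinner_scaleC_left: "cinner (c *\<^sub>C x) y = cnj c * cinner x y"
  for x y :: "'h::chilbert_space"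
  by (metis cinner_commute cinner_scaleC_right complex_cnj_mult)

lemma cinner_scaleR_right: "cinner x (r *\<^sub>R y) = r *\<^sub>R cinner x y"
  for x y :: "'h::chilbert_space"
  by (metis cinner_scaleC_right scaleC_of_real scaleR_conv_of_real)

lemma cinner_scaleR_left: "cinner (r *\<^sub>R x) y = r *\<^sub>R cinner x y"
  for x y :: "'h::chilbert_space"
  by (metis cinner_commute cinner_scaleR_right complex_cnj_scaleR)

lemma Re_cinner_commute: "Re (cinner x y) = Re (cinner y x)"
  for x y :: "'h::chilbert_space"
  by (metis cinner_commute complex_cnj(1) complex.collapse complex.sel(1))

lemma norm_add_sq: "(norm (x + y))\<^sup>2 = (norm x)\<^sup>2 + (norm y)\<^sup>2 + 2 * Re (cinner x y)"
  for x y :: "'h::chilbert_space"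
proof -
  have "complex_of_real ((norm (x + y))\<^sup>2) = cinner (x + y) (x + y)"
    by (simp add: cinner_self)
  also have "\<dots> = cinner x x + cinner y y + (cinner x y + cinner y x)"
    by (simp add: cinner_add_left cinner_add_right)
  finally have "(norm (x + y))\<^sup>2 = Re (cinner x x + cinner y y + (cinner x y + cinner y x))"
    by (metis Re_complex_of_real)
  then show ?thesis
    using Re_cinner_commute[of x y] by (simp add: cinner_self del: of_real_power)
qed

lemma cinner_Cauchy_Schwarz: "cmod (cinner x y) \<le> norm x * norm y"
  for x y :: "'h::chilbert_space"
proof (cases "y = 0")
  case True
  have "cinner x (0 *\<^sub>R y) = 0" by (simp only: cinner_scaleR_right) simp
  with True show ?thesis by simp
next
  case False
  define c where "c = - (cnj (cinner x y) / complex_of_real ((norm y)\<^sup>2))"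
  have ny: "(norm y)\<^sup>2 > 0" using False by simp
  have cm: "cmod c = cmod (cinner x y) / (norm y)\<^sup>2"
    by (simp add: c_def norm_divide norm_power del: of_real_power)
  have "c * cinner x y = - complex_of_real ((cmod (cinner x y))\<^sup>2 / (norm y)\<^sup>2)"
    unfolding c_def by (simp add: complex_norm_square mult.commute del: of_real_power)
  then have re: "Re (cinner x (c *\<^sub>C y)) = - ((cmod (cinner x y))\<^sup>2 / (norm y)\<^sup>2)"
    by (simp only: cinner_scaleC_right) simp
  have "(norm (c *\<^sub>C y))\<^sup>2 = (cmod (cinner x y))\<^sup>2 / (norm y)\<^sup>2"
    using ny by (simp add: norm_scaleC cm power_mult_distrib power_divide power2_eq_square)
  then have "(norm (x + c *\<^sub>C y))\<^sup>2 = (norm x)\<^sup>2 - (cmod (cinner x y))\<^sup>2 / (norm y)\<^sup>2"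
    using re by (simp add: norm_add_sq)
  then have "(cmod (cinner x y))\<^sup>2 / (norm y)\<^sup>2 \<le> (norm x)\<^sup>2"
    by (smt (verit) zero_le_power2)
  then have "(cmod (cinner x y))\<^sup>2 \<le> (norm x * norm y)\<^sup>2"
    using ny by (simp add: field_simps power_mult_distrib)
  then show ?thesis by (rule power2_le_imp_le) simp
qed

interpretation cinner: bounded_bilinear "cinner :: 'h::chilbert_space \<Rightarrow> 'h \<Rightarrow> complex"
  by standard (auto simp: cinner_add_left cinner_add_right cinner_scaleR_left cinner_scaleR_right
      intro!: exI[of _ 1] cinner_Cauchy_Schwarz)

lemma norm_diff_sq: "(norm (x - y))\<^sup>2 = (norm x)\<^sup>2 + (norm y)\<^sup>2 - 2 * Re (cinner x y)"
  for x y :: "'h::chilbert_space"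
  using norm_add_sq[of x "- y"] by (simp add: cinner.minus_right)

lemma Re_cinner_self: "Re (cinner x x) = (norm x)\<^sup>2" for x :: "'h::chilbert_space"
  by (simp add: cinner_self del: of_real_power)

lemma cinner_ext: "x = y" if "\<And>z. cinner x z = cinner y z" for x y :: "'h::chilbert_space"
proof -
  have "cinner (x - y) (x - y) = 0" using that by (simp add: cinner.diff_left)
  then show ?thesis by (simp add: cinner_self)
qed

lemma ex_orthogonal_vector:
  fixes L :: "'h::chilbert_space set"
  assumes "closed L" "subspace L" "L \<noteq> UNIV" and C: "\<And>c x. x \<in> L \<Longrightarrow> c *\<^sub>C x \<in> L"
  obtains z where "z \<noteq> 0" "\<And>y. y \<in> L \<Longrightarrow> cinner y z = 0"
proof -
  obtain x0 where x0: "x0 \<notin> L" using assms(3) by auto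
  have L0: "0 \<in> L" "L \<noteq> {}" using assms(2) by (auto simp: subspace_def)
  define d where "d = infdist x0 L"
  have dle: "d \<le> norm (x0 - y)" if "y \<in> L" for y
    using infdist_le[OF that, of x0] by (simp add: d_def dist_norm)
  have d0: "d \<ge> 0" by (simp add: d_def infdist_nonneg)
  have "\<exists>y\<in>L. norm (x0 - y) < d + inverse (Suc n)" for n
  proof (rule ccontr)
    assume "\<not> ?thesis"
    then have "d + inverse (Suc n) \<le> norm (x0 - y)" if "y \<in> L" for y using that by force
    then have "d + inverse (Suc n) \<le> infdist x0 L"
      unfolding infdist_notempty[OF L0(2)] dist_norm by (intro cINF_greatest L0(2)) auto
    moreover have "inverse (real (Suc n)) > 0" by simp
    ultimately show False by (simp add: d_def)
  qed
  then obtain y where y: "\<And>n. y n \<in> L" "\<And>n. norm (x0 - y n) < d + inverse (real (Suc n))"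
    by metis
  have lim: "(\<lambda>n. norm (x0 - y n)) \<longlonglongrightarrow> d"
  proof (rule tendsto_sandwich)
    show "\<forall>\<^sub>F n in sequentially. d \<le> norm (x0 - y n)"
      using dle y(1) by simp
    show "\<forall>\<^sub>F n in sequentially. norm (x0 - y n) \<le> d + inverse (real (Suc n))"
      using y(2) by (intro always_eventually allI less_imp_le)
    show "(\<lambda>n. d + inverse (real (Suc n))) \<longlonglongrightarrow> d"
      using tendsto_add[OF tendsto_const LIMSEQ_inverse_real_of_nat, of d] by simp
  qed simp
  have par: "(norm (y m - y n))\<^sup>2 \<le> 2 * ((norm (x0 - y m))\<^sup>2 - d\<^sup>2) + 2 * ((norm (x0 - y n))\<^sup>2 - d\<^sup>2)" for m n
  proof -
    have "(1/2) *\<^sub>R (y m + y n) \<in> L"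
      using assms(2) y(1) by (intro subspace_scale subspace_add) auto
    from dle[OF this] have "d\<^sup>2 \<le> (norm (x0 - (1/2) *\<^sub>R (y m + y n)))\<^sup>2"
      using d0 by (intro power_mono) auto
    moreover have "x0 - (1/2) *\<^sub>R (y m + y n) = (1/2) *\<^sub>R ((x0 - y m) + (x0 - y n))"
      by (simp add: algebra_simps flip: scaleR_add_left)
    ultimately have "4 * d\<^sup>2 \<le> (norm ((x0 - y m) + (x0 - y n)))\<^sup>2"
      by (simp add: power_divide)
    moreover have "y m - y n = (x0 - y n) - (x0 - y m)" by simp
    then have "(norm (y m - y n))\<^sup>2 = (norm ((x0 - y n) - (x0 - y m)))\<^sup>2" by simp
    ultimately show ?thesis
      using norm_add_sq[of "x0 - y m" "x0 - y n"] norm_diff_sq[of "x0 - y n" "x0 - y m"]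
      by (simp add: Re_cinner_commute[of "x0 - y n"] right_diff_distrib)
  qed
  have "Cauchy y"
  proof (rule metric_CauchyI)
    fix e :: real assume e: "e > 0"
    have "(\<lambda>n. (norm (x0 - y n))\<^sup>2 - d\<^sup>2) \<longlonglongrightarrow> d\<^sup>2 - d\<^sup>2"
      by (intro tendsto_intros lim)
    then have "\<forall>\<^sub>F n in sequentially. (norm (x0 - y n))\<^sup>2 - d\<^sup>2 < e\<^sup>2 / 4"
      using e by (intro order_tendstoD(2)) auto
    then obtain k where k: "\<And>n. n \<ge> k \<Longrightarrow> (norm (x0 - y n))\<^sup>2 - d\<^sup>2 < e\<^sup>2 / 4"
      by (auto simp: eventually_sequentially)
    have "dist (y m) (y n) < e" if "m \<ge> k" "n \<ge> k" for m n
    proof -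
      have "(norm (y m - y n))\<^sup>2 < e\<^sup>2" using par[of m n] k[OF that(1)] k[OF that(2)] by (simp add: right_diff_distrib)
      then show ?thesis using e by (simp add: dist_norm power2_less_imp_less)
    qed
    then show "\<exists>k. \<forall>m\<ge>k. \<forall>n\<ge>k. dist (y m) (y n) < e" by blast
  qed
  then obtain l where l: "y \<longlonglongrightarrow> l" by (auto simp: Cauchy_convergent_iff convergent_def)
  have lL: "l \<in> L" using assms(1) y(1) l by (auto simp: closed_sequential_limits)
  have "(\<lambda>n. norm (x0 - y n)) \<longlonglongrightarrow> norm (x0 - l)" by (intro tendsto_intros l)
  with lim have nd: "norm (x0 - l) = d" by (metis LIMSEQ_unique)
  define z where "z = x0 - l"
  have R0: "Re (cinner w z) = 0" if w: "w \<in> L" for w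
  proof -
    define t where "t = Re (cinner w z) / ((norm w)\<^sup>2 + 1)"
    have "l + t *\<^sub>R w \<in> L" using assms(2) lL w by (intro subspace_scale subspace_add)
    then have "d\<^sup>2 \<le> (norm (x0 - (l + t *\<^sub>R w)))\<^sup>2" using dle d0 by (intro power_mono) auto
    also have "x0 - (l + t *\<^sub>R w) = z - t *\<^sub>R w" by (simp add: z_def)
    also have "(norm (z - t *\<^sub>R w))\<^sup>2 = d\<^sup>2 + t\<^sup>2 * (norm w)\<^sup>2 - 2 * (t * Re (cinner w z))"
      using nd by (simp add: norm_diff_sq z_def[symmetric] cinner_scaleR_right power_mult_distrib
          Re_cinner_commute[of z])
    also have "Re (cinner w z) = t * ((norm w)\<^sup>2 + 1)"
      by (simp add: t_def add_nonneg_eq_0_iff)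
    finally have "t\<^sup>2 * ((norm w)\<^sup>2 + 2) \<le> 0" by (simp add: algebra_simps power2_eq_square)
    then have "t = 0" by (smt (verit) mult_pos_pos zero_le_power2 zero_eq_power2)
    then show ?thesis
      using \<open>Re (cinner w z) = t * ((norm w)\<^sup>2 + 1)\<close> by simp
  qed
  show thesis
  proof
    show "z \<noteq> 0" using x0 lL by (auto simp: z_def)
    show "cinner w z = 0" if w: "w \<in> L" for w
    proof (rule complex_eqI)
      have "Re (cinner (\<i> *\<^sub>C w) z) = 0" using C[OF w] by (rule R0)
      then show "Im (cinner w z) = Im 0" by (simp add: cinner_scaleC_left)
    qed (simp add: R0 w)
  qed
qed

section \<open>Adjoints and invertible operators\<close>

lemma Riesz_representation:
  fixes f :: "'h::chilbert_space \<Rightarrow> complex"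
  assumes f: "bounded_linear f" and C: "\<And>c x. f (c *\<^sub>C x) = c * f x"
  shows "\<exists>z. \<forall>x. f x = cinner z x"
proof (cases "\<forall>x. f x = 0")
  case True
  then show ?thesis by (intro exI[of _ 0]) (simp add: cinner.zero_left)
next
  case False
  interpret f: bounded_linear f by fact
  define L where "L = {x. f x = 0}"
  have cl: "closed L" unfolding L_def
    by (intro closed_Collect_eq continuous_intros linear_continuous_on f)
  have su: "subspace L" by (auto simp: L_def subspace_def f.add f.scaleR f.zero)
  have ne: "L \<noteq> UNIV" using False by (auto simp: L_def)
  have cL: "\<And>c x. x \<in> L \<Longrightarrow> c *\<^sub>C x \<in> L" by (simp add: L_def C)
  obtain z where z: "z \<noteq> 0" "\<And>y. y \<in> L \<Longrightarrow> cinner y z = 0"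
    using ex_orthogonal_vector[OF cl su ne cL] by blast
  have zz: "cinner z z \<noteq> 0" using z by (simp add: cinner_self)
  have "f z * cinner z x = f x * cinner z z" for x
  proof -
    have "f z *\<^sub>C x - f x *\<^sub>C z \<in> L" by (simp add: L_def f.diff C mult.commute)
    from z(2)[OF this] have "cinner z (f z *\<^sub>C x - f x *\<^sub>C z) = 0"
      by (metis cinner_commute complex_cnj_zero)
    then show ?thesis by (simp add: cinner.diff_right cinner_scaleC_right)
  qed
  then have "f x = cinner (cnj (f z / cinner z z) *\<^sub>C z) x" for x
    using zz by (simp add: cinner_scaleC_left field_simps)
  then show ?thesis by blast
qed

lemma bounded_ops_scaleC: "T \<in> bounded_ops \<Longrightarrow> blinfun_apply T (c *\<^sub>C x) = c *\<^sub>C blinfun_apply T x"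
  by (simp add: bounded_ops_def)

lemma adj_eqI: "adj T = S"
  if "\<And>x y. cinner (blinfun_apply S x) y = cinner x (blinfun_apply T y)"
  unfolding adj_def
proof (rule the_equality)
  show "S' = S" if S': "\<forall>x y. cinner (blinfun_apply S' x) y = cinner x (blinfun_apply T y)" for S'
    by (rule blinfun_eqI, rule cinner_ext)
       (simp add: S' \<open>\<And>x y. cinner (blinfun_apply S x) y = cinner x (blinfun_apply T y)\<close>)
qed (use that in blast)

lemma ex_adjoint:
  fixes T :: "'h::chilbert_space \<Rightarrow>\<^sub>L 'h"
  assumes T: "T \<in> bounded_ops"
  shows "\<exists>S. \<forall>x y. cinner (blinfun_apply S x) y = cinner x (blinfun_apply T y)"
proof -
  have "\<exists>z. \<forall>y. cinner x (blinfun_apply T y) = cinner z y" for x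
    by (rule Riesz_representation[OF bounded_linear_compose[OF cinner.bounded_linear_right
            blinfun.bounded_linear_right]])
       (simp add: bounded_ops_scaleC[OF T] cinner_scaleC_right)
  then obtain S where S: "\<And>x y. cinner (S x) y = cinner x (blinfun_apply T y)" by metis
  have "bounded_linear S"
  proof (rule bounded_linear_intro[where K = "norm T"])
    fix x y and r :: real
    show "S (x + y) = S x + S y" "S (r *\<^sub>R x) = r *\<^sub>R S x"
      by (rule cinner_ext; simp add: S cinner_add_left cinner_scaleR_left)+
    have "(norm (S x))\<^sup>2 = Re (cinner x (blinfun_apply T (S x)))"
      by (simp add: S[symmetric] Re_cinner_self)
    also have "\<dots> \<le> norm x * norm (blinfun_apply T (S x))"
      by (rule order_trans[OF complex_Re_le_cmod cinner_Cauchy_Schwarz])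
    also have "\<dots> \<le> norm x * (norm T * norm (S x))"
      by (intro mult_left_mono norm_blinfun) simp
    finally show "norm (S x) \<le> norm x * norm T"
      by (cases "S x = 0") (auto simp: power2_eq_square algebra_simps)
  qed
  then show ?thesis
    by (intro exI[of _ "Blinfun S"]) (simp add: bounded_linear_Blinfun_apply S)
qed

lemma cinner_adj_left:
  "T \<in> bounded_ops \<Longrightarrow> cinner (blinfun_apply (adj T) x) y = cinner x (blinfun_apply T y)"
  using ex_adjoint adj_eqI by metis

lemma cinner_adj_right:
  "T \<in> bounded_ops \<Longrightarrow> cinner x (blinfun_apply (adj T) y) = cinner (blinfun_apply T x) y"
  by (metis cinner_adj_left cinner_commute)

interpretation blinfun_compose: bounded_bilinear "(o\<^sub>L)"
  by (rule bounded_bilinear_blinfun_compose)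

lemma blinfun_compose_assoc: "(A o\<^sub>L B) o\<^sub>L C = A o\<^sub>L (B o\<^sub>L C)"
  by (rule blinfun_eqI) simp

lemma blinfun_compose_id [simp]: "id_blinfun o\<^sub>L A = A" "A o\<^sub>L id_blinfun = A"
  by (auto intro!: blinfun_eqI)

lemmas op_ring_simps = blinfun_compose.add_left blinfun_compose.add_right
  blinfun_compose.diff_left blinfun_compose.diff_right blinfun_compose.minus_left
  blinfun_compose.minus_right blinfun_compose.scaleR_left blinfun_compose.scaleR_right
  blinfun_compose_assoc

lemma scaleC_scaleR_commute: "c *\<^sub>C r *\<^sub>R x = r *\<^sub>R c *\<^sub>C x" for x :: "'h::chilbert_space"
  by (simp add: scaleC_of_real[symmetric] scaleC_scaleC mult.commute)

lemma scaleC_diff_right: "c *\<^sub>C (x - y) = c *\<^sub>C x - c *\<^sub>C y" for x y :: "'h::chilbert_space"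
  using bounded_linear_scaleC by (rule linear_diff[OF bounded_linear.linear])

lemma scaleC_minus_right: "c *\<^sub>C (- x) = - (c *\<^sub>C x)" for x :: "'h::chilbert_space"
  using bounded_linear_scaleC by (rule linear_neg[OF bounded_linear.linear])

lemma scaleC_zero_right: "c *\<^sub>C 0 = (0 :: 'h::chilbert_space)"
  using bounded_linear_scaleC by (rule linear_0[OF bounded_linear.linear])

lemma bounded_ops_closed_under [intro, simp]:
  fixes A B :: "'h::chilbert_space \<Rightarrow>\<^sub>L 'h"
  shows "0 \<in> (bounded_ops :: ('h \<Rightarrow>\<^sub>L 'h) set)"
    "id_blinfun \<in> (bounded_ops :: ('h \<Rightarrow>\<^sub>L 'h) set)"
    "scalar_op c \<in> (bounded_ops :: ('h \<Rightarrow>\<^sub>L 'h) set)"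
    "A \<in> bounded_ops \<Longrightarrow> B \<in> bounded_ops \<Longrightarrow> A + B \<in> bounded_ops"
    "A \<in> bounded_ops \<Longrightarrow> B \<in> bounded_ops \<Longrightarrow> A - B \<in> bounded_ops"
    "A \<in> bounded_ops \<Longrightarrow> - A \<in> bounded_ops"
    "A \<in> bounded_ops \<Longrightarrow> r *\<^sub>R A \<in> bounded_ops"
    "A \<in> bounded_ops \<Longrightarrow> B \<in> bounded_ops \<Longrightarrow> A o\<^sub>L B \<in> bounded_ops"
  by (auto simp: bounded_ops_def blinfun.bilinear_simps scaleC_add_right scaleC_diff_right scaleC_minus_right
      scaleC_zero_right scaleC_scaleR_commute scalar_op_apply scaleC_scaleC mult.commute)

lemma adj_bounded_ops [intro, simp]: "adj T \<in> bounded_ops" if "T \<in> bounded_ops"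
proof -
  have "blinfun_apply (adj T) (c *\<^sub>C x) = c *\<^sub>C blinfun_apply (adj T) x" for c x
    by (rule cinner_ext) (simp add: cinner_adj_left that cinner_scaleC_left)
  then show ?thesis by (simp add: bounded_ops_def)
qed

lemma adj_adj: "T \<in> bounded_ops \<Longrightarrow> adj (adj T) = T"
  by (rule adj_eqI) (simp add: cinner_adj_right)

lemma adj_add: "A \<in> bounded_ops \<Longrightarrow> B \<in> bounded_ops \<Longrightarrow> adj (A + B) = adj A + adj B"
  by (rule adj_eqI) (simp add: cinner_adj_left blinfun.bilinear_simps cinner_add_left cinner_add_right)

lemma adj_diff: "A \<in> bounded_ops \<Longrightarrow> B \<in> bounded_ops \<Longrightarrow> adj (A - B) = adj A - adj B"
  by (rule adj_eqI) (simp add: cinner_adj_left blinfun.bilinear_simps cinner.diff_left cinner.diff_right)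

lemma adj_minus: "A \<in> bounded_ops \<Longrightarrow> adj (- A) = - adj A"
  by (rule adj_eqI) (simp add: cinner_adj_left blinfun.bilinear_simps cinner.minus_left cinner.minus_right)

lemma adj_scaleR: "A \<in> bounded_ops \<Longrightarrow> adj (r *\<^sub>R A) = r *\<^sub>R adj A"
  by (rule adj_eqI) (simp add: cinner_adj_left blinfun.bilinear_simps cinner_scaleR_left cinner_scaleR_right)

lemma adj_compose: "A \<in> bounded_ops \<Longrightarrow> B \<in> bounded_ops \<Longrightarrow> adj (A o\<^sub>L B) = adj B o\<^sub>L adj A"
  by (rule adj_eqI) (simp add: cinner_adj_left)

lemma adj_scalar_op: "adj (scalar_op c) = (scalar_op (cnj c) :: 'h::chilbert_space \<Rightarrow>\<^sub>L 'h)"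
  by (rule adj_eqI) (simp add: scalar_op_apply cinner_scaleC_left cinner_scaleC_right)

lemma scalar_op_of_real: "scalar_op (complex_of_real r) = r *\<^sub>R id_blinfun"
  by (rule blinfun_eqI) (simp add: scalar_op_apply scaleC_of_real blinfun.scaleR_left)

lemma scalar_op_1: "scalar_op 1 = id_blinfun"
  using scalar_op_of_real[of 1] by simp

lemma adj_id: "adj id_blinfun = (id_blinfun :: 'h::chilbert_space \<Rightarrow>\<^sub>L 'h)"
  by (rule adj_eqI) simp

lemma adj_0: "adj 0 = (0 :: 'h::chilbert_space \<Rightarrow>\<^sub>L 'h)"
  by (rule adj_eqI) (simp add: cinner.zero_left cinner.zero_right)

lemma scalar_op_compose: "scalar_op c o\<^sub>L scalar_op d = scalar_op (c * d)"
  by (rule blinfun_eqI) (simp add: scalar_op_apply scaleC_scaleC)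

lemma scalar_op_add: "scalar_op c + scalar_op d = scalar_op (c + d)"
  by (rule blinfun_eqI) (simp add: scalar_op_apply scaleC_add_left blinfun.add_left)

lemma scalar_op_commute: "A \<in> bounded_ops \<Longrightarrow> A o\<^sub>L scalar_op c = scalar_op c o\<^sub>L A"
  by (rule blinfun_eqI) (simp add: scalar_op_apply bounded_ops_scaleC)

lemma closed_bounded_ops: "closed (bounded_ops :: ('h::chilbert_space \<Rightarrow>\<^sub>L 'h) set)"
proof -
  have "bounded_ops = (\<Inter>c. \<Inter>x. {T :: 'h \<Rightarrow>\<^sub>L 'h. blinfun_apply T (c *\<^sub>C x) = c *\<^sub>C blinfun_apply T x})"
    unfolding bounded_ops_def by blast
  also have "closed \<dots>"
  proof (intro closed_INT ballI closed_Collect_eq)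
    fix c and x :: 'h
    have 1: "bounded_linear (\<lambda>T. blinfun_apply T y)" for y :: 'h
      by (rule blinfun.bounded_linear_left)
    show "continuous_on UNIV (\<lambda>T :: 'h \<Rightarrow>\<^sub>L 'h. blinfun_apply T (c *\<^sub>C x))"
      by (rule linear_continuous_on[OF 1])
    show "continuous_on UNIV (\<lambda>T :: 'h \<Rightarrow>\<^sub>L 'h. c *\<^sub>C blinfun_apply T x)"
      by (rule linear_continuous_on[OF bounded_linear_compose[OF bounded_linear_scaleC 1]])
  qed
  finally show ?thesis .
qed

definition op_invertible :: "('h::chilbert_space \<Rightarrow>\<^sub>L 'h) \<Rightarrow> bool"
  where "op_invertible A \<longleftrightarrow> (\<exists>S\<in>bounded_ops. S o\<^sub>L A = id_blinfun \<and> A o\<^sub>L S = id_blinfun)"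

lemma spectrum_iff_not_invertible: "z \<in> spectrum T \<longleftrightarrow> \<not> op_invertible (T - scalar_op z)"
  by (simp add: spectrum_def op_invertible_def)

lemma op_invertible_compose: "op_invertible A \<Longrightarrow> op_invertible B \<Longrightarrow> op_invertible (A o\<^sub>L B)"
proof -
  assume "op_invertible A" "op_invertible B"
  then obtain S R where S: "S \<in> bounded_ops" "S o\<^sub>L A = id_blinfun" "A o\<^sub>L S = id_blinfun"
    and R: "R \<in> bounded_ops" "R o\<^sub>L B = id_blinfun" "B o\<^sub>L R = id_blinfun"
    unfolding op_invertible_def by blast
  have "(R o\<^sub>L S) o\<^sub>L (A o\<^sub>L B) = R o\<^sub>L ((S o\<^sub>L A) o\<^sub>L B)"
    "(A o\<^sub>L B) o\<^sub>L (R o\<^sub>L S) = A o\<^sub>L ((B o\<^sub>L R) o\<^sub>L S)"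
    by (simp_all only: blinfun_compose_assoc)
  then show ?thesis unfolding op_invertible_def
    using S R by (intro bexI[of _ "R o\<^sub>L S"]) simp_all
qed

lemma op_invertible_bounded_below:
  assumes "op_invertible A"
  obtains c where "c > 0" "\<And>x. c * norm x \<le> norm (blinfun_apply A x)"
proof -
  obtain S where S: "S o\<^sub>L A = id_blinfun" using assms by (auto simp: op_invertible_def)
  show thesis
  proof
    have pos: "norm S + 1 > 0" by (simp add: add_nonneg_pos)
    then show "inverse (norm S + 1) > 0" by simp
    fix x
    have "norm x = norm (blinfun_apply S (blinfun_apply A x))"
      by (metis S blinfun_apply_blinfun_compose blinfun_apply_id_blinfun)
    also have "\<dots> \<le> norm S * norm (blinfun_apply A x)" by (rule norm_blinfun)
    also have "\<dots> \<le> (norm S + 1) * norm (blinfun_apply A x)" by (intro mult_right_mono) auto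
    finally show "inverse (norm S + 1) * norm x \<le> norm (blinfun_apply A x)"
      using pos by (simp add: pos_divide_le_eq mult.commute inverse_eq_divide)
  qed
qed

lemma op_invertible_of_bounded_below:
  assumes A: "A \<in> bounded_ops" and c: "c > 0"
    and le: "\<And>x. c * norm x \<le> norm (blinfun_apply A x)"
    and adj0: "\<And>x. blinfun_apply (adj A) x = 0 \<Longrightarrow> x = 0"
  shows "op_invertible A"
proof -
  let ?A = "blinfun_apply A"
  have inj: "x = y" if "?A x = ?A y" for x y
  proof -
    have "c * norm (x - y) \<le> 0" using le[of "x - y"] that by (simp add: blinfun.diff_right)
    then show ?thesis using c by (simp add: mult_le_0_iff)
  qed
  have cl: "closed (range ?A)"
    unfolding closed_sequential_limits
  proof (intro allI impI, elim conjE)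
    fix y l assume y: "\<forall>n. y n \<in> range ?A" and l: "y \<longlonglongrightarrow> l"
    then have "\<exists>x. \<forall>n. y n = ?A (x n)" by (intro choice) blast
    then obtain x where x: "\<And>n. y n = ?A (x n)" by blast
    have "Cauchy x"
    proof (rule metric_CauchyI)
      fix e :: real assume e: "e > 0"
      then have "c * e > 0" using c by simp
      then obtain k where k: "\<And>m n. m \<ge> k \<Longrightarrow> n \<ge> k \<Longrightarrow> dist (y m) (y n) < c * e"
        using metric_CauchyD[OF LIMSEQ_imp_Cauchy[OF l], of "c * e"] by auto
      have "dist (x m) (x n) < e" if "m \<ge> k" "n \<ge> k" for m n
      proof -
        have "c * norm (x m - x n) < c * e"
          using le_less_trans[OF le k[OF that, unfolded dist_norm x blinfun.diff_right[symmetric]]] .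
        then show ?thesis using c by (simp add: dist_norm)
      qed
      then show "\<exists>k. \<forall>m\<ge>k. \<forall>n\<ge>k. dist (x m) (x n) < e" by blast
    qed
    then obtain x0 where "x \<longlonglongrightarrow> x0" by (auto simp: Cauchy_convergent_iff convergent_def)
    then have "(\<lambda>n. ?A (x n)) \<longlonglongrightarrow> ?A x0" by (intro blinfun.tendsto tendsto_const)
    then have "y \<longlonglongrightarrow> ?A x0" by (simp add: x[symmetric])
    then show "l \<in> range ?A" using l LIMSEQ_unique by blast
  qed
  have surj: "range ?A = UNIV"
  proof (rule ccontr)
    assume ne: "range ?A \<noteq> UNIV"
    have su: "subspace (range ?A)"
      by (rule linear_subspace_image) (auto simp: blinfun.bounded_linear_right bounded_linear.linear)
    have cL: "c *\<^sub>C x \<in> range ?A" if "x \<in> range ?A" for c x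
      using that by (auto simp: bounded_ops_scaleC[OF A, symmetric])
    obtain z where z: "z \<noteq> 0" "\<And>y. y \<in> range ?A \<Longrightarrow> cinner y z = 0"
      using ex_orthogonal_vector[OF cl su ne cL] by blast
    have "cinner x (blinfun_apply (adj A) z) = 0" for x
      by (simp add: cinner_adj_right[OF A] z)
    from this[of "blinfun_apply (adj A) z"] have "blinfun_apply (adj A) z = 0"
      by (simp add: cinner_self)
    with adj0 z show False by blast
  qed
  define S where "S = inv ?A"
  have AS: "?A (S y) = y" for y unfolding S_def using surj by (simp add: surj_f_inv_f)
  have bl: "bounded_linear S"
  proof (rule bounded_linear_intro[where K = "inverse c"])
    show "S (x + y) = S x + S y" "S (r *\<^sub>R x) = r *\<^sub>R S x" for x y r
      by (rule inj; simp add: AS blinfun.bilinear_simps)+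
    show "norm (S x) \<le> norm x * inverse c" for x
      using le[of "S x"] c by (simp add: AS field_simps)
  qed
  show ?thesis unfolding op_invertible_def
  proof (intro bexI[of _ "Blinfun S"] conjI)
    have "S (c *\<^sub>C x) = c *\<^sub>C S x" for c x
      by (rule inj) (simp add: AS bounded_ops_scaleC[OF A])
    then show "Blinfun S \<in> bounded_ops"
      by (simp add: bounded_ops_def bounded_linear_Blinfun_apply[OF bl])
    have "S (?A x) = x" for x by (rule inj) (simp add: AS)
    then show "Blinfun S o\<^sub>L A = id_blinfun" "A o\<^sub>L Blinfun S = id_blinfun"
      by (simp_all add: bounded_linear_Blinfun_apply[OF bl] AS blinfun_eqI)
  qed
qed

section \<open>Self-adjoint operators and polynomials\<close>

definition hermitian :: "('h::chilbert_space \<Rightarrow>\<^sub>L 'h) \<Rightarrow> bool"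
  where "hermitian T \<longleftrightarrow> T \<in> bounded_ops \<and> adj T = T"

lemma hermitianD:
  assumes "hermitian T"
  shows "T \<in> bounded_ops" "adj T = T"
    "cinner (blinfun_apply T x) y = cinner x (blinfun_apply T y)"
  using assms cinner_adj_left[of T x y] by (auto simp: hermitian_def)

lemma hermitian_norm_sq:
  "hermitian A \<Longrightarrow> Re (cinner x (blinfun_apply A (blinfun_apply A x))) = (norm (blinfun_apply A x))\<^sup>2"
  by (metis hermitianD(3) Re_cinner_self)

lemma hermitianI:
  "T \<in> bounded_ops \<Longrightarrow>
    (\<And>x y. cinner (blinfun_apply T x) y = cinner x (blinfun_apply T y)) \<Longrightarrow> hermitian T"
  using adj_eqI[of T T] by (simp add: hermitian_def)

lemma hermitian_closed_under:
  fixes A B :: "'h::chilbert_space \<Rightarrow>\<^sub>L 'h"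
  shows "hermitian (id_blinfun :: 'h \<Rightarrow>\<^sub>L 'h)" "hermitian (0 :: 'h \<Rightarrow>\<^sub>L 'h)"
    "hermitian A \<Longrightarrow> hermitian B \<Longrightarrow> hermitian (A + B)"
    "hermitian A \<Longrightarrow> hermitian B \<Longrightarrow> hermitian (A - B)"
    "hermitian A \<Longrightarrow> hermitian (r *\<^sub>R A)"
    "hermitian A \<Longrightarrow> hermitian B \<Longrightarrow> A o\<^sub>L B = B o\<^sub>L A \<Longrightarrow> hermitian (A o\<^sub>L B)"
  by (simp_all add: hermitian_def adj_id adj_0 adj_add adj_diff adj_scaleR adj_compose)

lemma closed_hermitian: "closed {S :: 'h::chilbert_space \<Rightarrow>\<^sub>L 'h. hermitian S}"
  unfolding closed_sequential_limits
proof (intro allI impI, elim conjE, unfold mem_Collect_eq)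
  fix S :: "nat \<Rightarrow> 'h \<Rightarrow>\<^sub>L 'h" and l
  assume S: "\<forall>n. hermitian (S n)" and l: "S \<longlonglongrightarrow> l"
  show "hermitian l"
  proof (rule hermitianI)
    show "l \<in> bounded_ops"
      using closed_bounded_ops S l hermitianD(1) unfolding closed_sequential_limits by blast
    fix x y
    have "(\<lambda>n. cinner (blinfun_apply (S n) x) y) \<longlonglongrightarrow> cinner (blinfun_apply l x) y"
      by (intro cinner.tendsto blinfun.tendsto l tendsto_const)
    moreover have "(\<lambda>n. cinner x (blinfun_apply (S n) y)) \<longlonglongrightarrow> cinner x (blinfun_apply l y)"
      by (intro cinner.tendsto blinfun.tendsto l tendsto_const)
    ultimately show "cinner (blinfun_apply l x) y = cinner x (blinfun_apply l y)"
      using S hermitianD(3) LIMSEQ_unique by (metis (no_types, lifting) ext)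
  qed
qed

lemma hermitian_invertible:
  assumes A: "hermitian A" and c: "c > 0"
    and le: "\<And>x. c * (norm x)\<^sup>2 \<le> \<bar>Re (cinner x (blinfun_apply A x))\<bar>"
  shows "op_invertible A"
proof -
  have below: "c * norm x \<le> norm (blinfun_apply A x)" for x
  proof -
    have "c * norm x * norm x \<le> \<bar>Re (cinner x (blinfun_apply A x))\<bar>"
      using le[of x] by (simp add: power2_eq_square mult.assoc)
    also have "\<dots> \<le> norm x * norm (blinfun_apply A x)"
      by (rule order_trans[OF abs_Re_le_cmod cinner_Cauchy_Schwarz])
    finally show ?thesis by (cases "x = 0") (auto simp: mult.commute)
  qed
  show ?thesis
  proof (rule op_invertible_of_bounded_below[OF hermitianD(1)[OF A] c below])
    show "x = 0" if "blinfun_apply (adj A) x = 0" for x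
      using below[of x] c that by (simp add: hermitianD(2)[OF A] mult_le_0_iff)
  qed
qed

lemma hermitian_norm_in_spectrum:
  fixes T :: "'h::chilbert_space \<Rightarrow>\<^sub>L 'h"
  assumes T: "hermitian T" and nt: "(id_blinfun :: 'h \<Rightarrow>\<^sub>L 'h) \<noteq> 0"
  shows "complex_of_real (norm T) \<in> spectrum T \<or> complex_of_real (- norm T) \<in> spectrum T"
proof (rule ccontr)
  assume notin: "\<not> (complex_of_real (norm T) \<in> spectrum T \<or> complex_of_real (- norm T) \<in> spectrum T)"
  define M where "M = norm T"
  have "op_invertible (T - M *\<^sub>R id_blinfun)" "op_invertible (T - (- M) *\<^sub>R id_blinfun)"
    using notin unfolding spectrum_iff_not_invertible scalar_op_of_real M_def by blast+
  then have "op_invertible ((T - M *\<^sub>R id_blinfun) o\<^sub>L (T - (- M) *\<^sub>R id_blinfun))"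
    by (rule op_invertible_compose)
  then obtain c where c: "c > 0"
    and le: "\<And>x. c * norm x \<le> norm (blinfun_apply ((T - M *\<^sub>R id_blinfun) o\<^sub>L (T - (- M) *\<^sub>R id_blinfun)) x)"
    by (rule op_invertible_bounded_below) blast
  let ?T = "blinfun_apply T"
  have M0: "M \<ge> 0" by (simp add: M_def)
  have key: "c\<^sup>2 * (norm x)\<^sup>2 \<le> M^4 * (norm x)\<^sup>2 - M\<^sup>2 * (norm (?T x))\<^sup>2" for x
  proof -
    have "c * norm x \<le> norm (?T (?T x) - M\<^sup>2 *\<^sub>R x)"
      using le[of x] by (simp add: blinfun.bilinear_simps power2_eq_square algebra_simps)
    then have "(c * norm x)\<^sup>2 \<le> (norm (?T (?T x) - M\<^sup>2 *\<^sub>R x))\<^sup>2"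
      using c by (intro power_mono) auto
    also have "\<dots> = (norm (?T (?T x)))\<^sup>2 + M^4 * (norm x)\<^sup>2 - 2 * (M\<^sup>2 * Re (cinner (?T (?T x)) x))"
      by (simp add: norm_diff_sq cinner_scaleR_right power_mult_distrib flip: power_mult)
    also have "Re (cinner (?T (?T x)) x) = (norm (?T x))\<^sup>2"
      by (simp add: hermitianD(3)[OF T, of "?T x"] Re_cinner_self)
    also have "(norm (?T (?T x)))\<^sup>2 \<le> M\<^sup>2 * (norm (?T x))\<^sup>2"
      using power_mono[OF norm_blinfun[of T "?T x"], of 2] by (simp add: M_def power_mult_distrib)
    finally show ?thesis by (simp add: power_mult_distrib)
  qed
  obtain x0 :: 'h where x0: "x0 \<noteq> 0"
    using nt by (metis blinfun_eqI blinfun_apply_id_blinfun zero_blinfun.rep_eq)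
  show False
  proof (cases "M = 0")
    case True
    then show False using key[of x0] c x0 by (simp add: mult_le_0_iff)
  next
    case False
    then have M2: "M\<^sup>2 > 0" by simp
    have le2: "(norm (?T x))\<^sup>2 \<le> (M\<^sup>2 - c\<^sup>2 / M\<^sup>2) * (norm x)\<^sup>2" for x
    proof -
      have "M\<^sup>2 * (norm (?T x))\<^sup>2 \<le> M\<^sup>2 * ((M\<^sup>2 - c\<^sup>2 / M\<^sup>2) * (norm x)\<^sup>2)"
        using key[of x] M2 by (simp add: algebra_simps flip: power_add)
      then show ?thesis using M2 by simp
    qed
    define K where "K = M\<^sup>2 - c\<^sup>2 / M\<^sup>2"
    have "0 \<le> K * (norm x0)\<^sup>2" using le2[of x0] by (simp add: K_def) (smt (verit) zero_le_power2)
    then have K0: "K \<ge> 0" using x0 by (simp add: zero_le_mult_iff)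
    have "norm (?T x) \<le> sqrt K * norm x" for x
      using real_sqrt_le_mono[OF le2[of x]] by (simp add: K_def[symmetric] real_sqrt_mult)
    then have "M \<le> sqrt K" unfolding M_def by (intro norm_blinfun_bound) (auto simp: K0)
    then have "M\<^sup>2 \<le> K" using K0 M0 by (metis power_mono real_sqrt_pow2)
    moreover have "c\<^sup>2 / M\<^sup>2 > 0" using c M2 by simp
    ultimately show False by (simp add: K_def)
  qed
qed

lemma op_poly_eq_sum:
  assumes "degree q \<le> n"
  shows "op_poly q T = (\<Sum>i\<le>n. coeff q i *\<^sub>R ((\<lambda>S. T o\<^sub>L S) ^^ i) id_blinfun)"
  unfolding op_poly_def
  by (rule sum.mono_neutral_left) (use assms in \<open>auto simp: coeff_eq_0\<close>)

lemma op_poly_0 [simp]: "op_poly 0 T = 0"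
  by (simp add: op_poly_def)

lemma op_poly_pCons: "op_poly (pCons a q) T = a *\<^sub>R id_blinfun + (T o\<^sub>L op_poly q T)"
proof -
  have "op_poly (pCons a q) T
      = (\<Sum>i\<le>Suc (degree q). coeff (pCons a q) i *\<^sub>R ((\<lambda>S. T o\<^sub>L S) ^^ i) id_blinfun)"
    by (rule op_poly_eq_sum) (simp add: degree_pCons_le)
  also have "\<dots> = a *\<^sub>R id_blinfun + (T o\<^sub>L op_poly q T)"
    unfolding sum.atMost_Suc_shift
    by (simp add: op_poly_def blinfun_compose.sum_right blinfun_compose.scaleR_right)
  finally show ?thesis .
qed

lemma op_poly_add: "op_poly (p + q) T = op_poly p T + op_poly q T"
proof (induction p arbitrary: q)
  case (pCons a p)
  then show ?case by (cases q) (simp add: op_poly_pCons op_ring_simps algebra_simps)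
qed simp

lemma op_poly_smult: "op_poly (smult c p) T = c *\<^sub>R op_poly p T"
  by (induction p) (simp_all add: op_poly_pCons op_ring_simps algebra_simps)

lemma op_poly_diff: "op_poly (p - q) T = op_poly p T - op_poly q T"
  using op_poly_add[of p "- q" T] op_poly_smult[of "-1" q T] by simp

lemma op_poly_mult: "op_poly (p * q) T = op_poly p T o\<^sub>L op_poly q T"
  by (induction p)
     (simp_all add: op_poly_pCons op_ring_simps op_poly_add op_poly_smult)

lemma op_poly_commute: "B o\<^sub>L T = T o\<^sub>L B \<Longrightarrow> B o\<^sub>L op_poly p T = op_poly p T o\<^sub>L B"
proof (induction p)
  case (pCons a p)
  then have "B o\<^sub>L (T o\<^sub>L op_poly p T) = T o\<^sub>L (op_poly p T o\<^sub>L B)"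
    by (simp flip: blinfun_compose_assoc add: pCons(3)) (simp add: blinfun_compose_assoc pCons)
  then show ?case by (simp add: op_poly_pCons op_ring_simps)
qed simp

lemma hermitian_op_poly: "hermitian T \<Longrightarrow> hermitian (op_poly p T)"
  by (induction p)
     (auto simp: op_poly_pCons op_poly_commute intro!: hermitian_closed_under)

lemma op_invertible_scaleR_id: "c \<noteq> 0 \<Longrightarrow> op_invertible (c *\<^sub>R (id_blinfun :: 'h::chilbert_space \<Rightarrow>\<^sub>L 'h))"
  unfolding op_invertible_def
  by (intro bexI[of _ "inverse c *\<^sub>R id_blinfun"]) (simp_all add: op_ring_simps)

lemma poly_map_of_real: "poly (map_poly complex_of_real p) (of_real x) = of_real (poly p x)"
  by (induction p) (simp_all add: map_poly_pCons)

lemma complex_root_dvd: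
  fixes r :: "real poly"
  assumes z: "poly (map_poly complex_of_real r) z = 0" and im: "Im z \<noteq> 0"
  shows "[:(Re z)\<^sup>2 + (Im z)\<^sup>2, - 2 * Re z, 1:] dvd r"
proof -
  define D where "D = [:(Re z)\<^sup>2 + (Im z)\<^sup>2, - 2 * Re z, 1:]"
  have D0: "D \<noteq> 0" "degree D = 2" by (simp_all add: D_def)
  have hom: "map_poly complex_of_real (p * q + s)
      = map_poly complex_of_real p * map_poly complex_of_real q + map_poly complex_of_real s" for p q s
    by (rule poly_eqI) (simp add: coeff_map_poly coeff_mult)
  have Dz: "poly (map_poly complex_of_real D) z = 0"
    by (simp add: D_def map_poly_pCons complex_eq_iff power2_eq_square algebra_simps)
  define m where "m = r mod D"
  have "r = r div D * D + m" by (simp add: m_def)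
  then have "poly (map_poly complex_of_real m) z = 0"
    using z Dz by (metis hom add_0 mult_zero_right poly_add poly_mult)
  moreover have "degree m \<le> 1"
    using degree_mod_less[OF D0(1), of r] D0(2) by (auto simp: m_def)
  then have "m = [:coeff m 0, coeff m 1:]"
    by (intro poly_eqI) (auto simp: coeff_pCons coeff_eq_0 split: nat.split)
  then obtain c d where cd: "m = [:c, d:]" by blast
  ultimately have "complex_of_real c + z * complex_of_real d = 0"
    by (simp add: map_poly_pCons)
  then have "d = 0" "c = 0" using im by (auto simp: complex_eq_iff)
  with cd have "r mod D = 0" by (simp add: m_def)
  then show ?thesis unfolding D_def[symmetric] by (simp add: mod_eq_0_iff_dvd)
qed

lemma op_invertible_op_poly:
  fixes T :: "'h::chilbert_space \<Rightarrow>\<^sub>L 'h"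
  assumes T: "hermitian T" and "r \<noteq> 0"
    and "\<And>t. complex_of_real t \<in> spectrum T \<Longrightarrow> poly r t \<noteq> 0"
  shows "op_invertible (op_poly r T)"
  using assms(2,3)
proof (induction "degree r" arbitrary: r rule: less_induct)
  case less
  show ?case
  proof (cases "degree r = 0")
    case True
    then obtain c where "r = [:c:]" using degree_eq_zeroE by blast
    with less.prems show ?thesis by (simp add: op_poly_pCons op_invertible_scaleR_id)
  next
    case False
    have split: ?thesis if D: "op_invertible (op_poly D T)" "D dvd r" "degree D > 0" for D
    proof -
      obtain s where s: "r = D * s" using D(2) by (elim dvdE)
      then have "s \<noteq> 0" "D \<noteq> 0" using less.prems by auto
      then have "degree s < degree r" using s D(3) by (simp add: degree_mult_eq)
      then have "op_invertible (op_poly s T)" using less s \<open>s \<noteq> 0\<close> by auto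
      with D(1) show ?thesis unfolding s op_poly_mult by (rule op_invertible_compose)
    qed
    have "degree (map_poly complex_of_real r) = degree r" by (rule degree_map_poly) simp
    then have "\<not> constant (poly (map_poly complex_of_real r))"
      using False by (simp add: constant_degree)
    then obtain z where z: "poly (map_poly complex_of_real r) z = 0"
      using fundamental_theorem_of_algebra by blast
    show ?thesis
    proof (cases "Im z = 0")
      case True
      then have zr: "z = complex_of_real (Re z)" by (simp add: complex_eq_iff)
      then have root: "poly r (Re z) = 0" using z by (metis poly_map_of_real of_real_eq_0_iff)
      then have "complex_of_real (Re z) \<notin> spectrum T" using less.prems by blast
      then have "op_invertible (op_poly [:- Re z, 1:] T)"
        by (simp add: spectrum_iff_not_invertible scalar_op_of_real op_poly_pCons)
      then show ?thesis by (rule split) (use root in \<open>auto simp: poly_eq_0_iff_dvd\<close>)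
    next
      case False
      let ?D = "[:(Re z)\<^sup>2 + (Im z)\<^sup>2, - 2 * Re z, 1:]"
      let ?A = "T - Re z *\<^sub>R id_blinfun"
      have D: "op_poly ?D T = (?A o\<^sub>L ?A) + (Im z)\<^sup>2 *\<^sub>R id_blinfun"
        by (simp add: op_poly_pCons op_ring_simps algebra_simps power2_eq_square)
           (simp flip: scaleR_add_left)
      have A: "hermitian ?A" by (intro hermitian_closed_under T)
      have "op_invertible (op_poly ?D T)"
      proof (rule hermitian_invertible[OF hermitian_op_poly[OF T]])
        show "(Im z)\<^sup>2 > 0" using False by simp
        fix x
        have "Re (cinner x (blinfun_apply (op_poly ?D T) x))
            = (norm (blinfun_apply ?A x))\<^sup>2 + (Im z)\<^sup>2 * (norm x)\<^sup>2"
          unfolding D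
          by (simp only: blinfun.add_left blinfun_apply_blinfun_compose cinner_add_right
              plus_complex.sel hermitian_norm_sq[OF A])
             (simp add: blinfun.scaleR_left cinner_scaleR_right Re_cinner_self)
        then show "(Im z)\<^sup>2 * (norm x)\<^sup>2 \<le> \<bar>Re (cinner x (blinfun_apply (op_poly ?D T) x))\<bar>"
          by simp
      qed
      then show ?thesis by (rule split) (use complex_root_dvd[OF z False] in auto)
    qed
  qed
qed

text \<open>The bound ranges over the real points of the spectrum only, because this is where
  \<^const>\<open>fun_calc\<close> compares a polynomial with the function.\<close>

lemma norm_op_poly_le:
  fixes T :: "'h::chilbert_space \<Rightarrow>\<^sub>L 'h"
  assumes T: "hermitian T" and nt: "(id_blinfun :: 'h \<Rightarrow>\<^sub>L 'h) \<noteq> 0"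
    and le: "\<And>t. complex_of_real t \<in> spectrum T \<Longrightarrow> \<bar>poly q t\<bar> \<le> B"
  shows "norm (op_poly q T) \<le> B"
proof -
  have ex: "\<exists>t. complex_of_real t \<in> spectrum T \<and> poly q t = m"
    if m: "complex_of_real m \<in> spectrum (op_poly q T)" for m
  proof (cases "q = [:m:]")
    case True
    then show ?thesis using hermitian_norm_in_spectrum[OF T nt] by fastforce
  next
    case False
    have eq: "op_poly (q - [:m:]) T = op_poly q T - scalar_op (complex_of_real m)"
      by (simp add: op_poly_diff op_poly_pCons scalar_op_of_real)
    have "\<not> op_invertible (op_poly (q - [:m:]) T)"
      using m by (simp add: spectrum_iff_not_invertible eq)
    moreover have "q - [:m:] \<noteq> 0" using False by simp
    ultimately obtain t where "complex_of_real t \<in> spectrum T" "poly (q - [:m:]) t = 0"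
      using op_invertible_op_poly[OF T] by blast
    then show ?thesis by auto
  qed
  from hermitian_norm_in_spectrum[OF hermitian_op_poly[OF T] nt, of q]
  show ?thesis
  proof
    assume "complex_of_real (norm (op_poly q T)) \<in> spectrum (op_poly q T)"
    from ex[OF this] le show ?thesis by force
  next
    assume "complex_of_real (- norm (op_poly q T)) \<in> spectrum (op_poly q T)"
    from ex[OF this] le show ?thesis by force
  qed
qed

lemma ex_uniform_limit_poly:
  fixes f :: "real \<Rightarrow> real"
  assumes f: "continuous_on {a..b} f"
  obtains q where "uniform_limit {a..b} (\<lambda>n. poly (q n)) f sequentially"
proof -
  have "\<exists>q. \<forall>x\<in>{a..b}. \<bar>f x - poly q x\<bar> < inverse (Suc n)" for n
  proof -
    have pos: "0 < inverse (real (Suc n))" by simp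
    obtain g where g: "real_polynomial_function g" "\<And>x. x \<in> {a..b} \<Longrightarrow> \<bar>f x - g x\<bar> < inverse (Suc n)"
      using Stone_Weierstrass_real_polynomial_function[OF compact_Icc f pos] by blast
    obtain c m where gm: "g = (\<lambda>x. \<Sum>i\<le>m. c i * x^i)"
      using g(1) unfolding real_polynomial_function_iff_sum by blast
    have "poly (\<Sum>i\<le>m. monom (c i) i) x = g x" for x
      by (simp add: gm poly_sum poly_monom)
    then show ?thesis using g(2) by (intro exI[of _ "\<Sum>i\<le>m. monom (c i) i"]) simp
  qed
  then obtain q where q: "\<And>n x. x \<in> {a..b} \<Longrightarrow> \<bar>f x - poly (q n) x\<bar> < inverse (real (Suc n))"
    by metis
  have "uniform_limit {a..b} (\<lambda>n. poly (q n)) f sequentially"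
  proof (rule uniform_limitI)
    fix e :: real assume "e > 0"
    then obtain N where N: "inverse (real (Suc N)) < e" using reals_Archimedean by blast
    have "dist (poly (q n) x) (f x) < e" if "n \<ge> N" "x \<in> {a..b}" for n x
    proof -
      have "inverse (real (Suc n)) \<le> inverse (real (Suc N))" using that by simp
      with q[OF that(2), of n] N show ?thesis
        unfolding dist_real_def abs_minus_commute[of "poly (q n) x"] by linarith
    qed
    then show "\<forall>\<^sub>F n in sequentially. \<forall>x\<in>{a..b}. dist (poly (q n) x) (f x) < e"
      unfolding eventually_sequentially by blast
  qed
  then show thesis by (rule that)
qed

section \<open>Continuous functional calculus\<close>

locale spectral_interval =
  fixes T :: "'h::chilbert_space \<Rightarrow>\<^sub>L 'h" and a b :: real
  assumes herm: "hermitian T"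
    and nontrivial: "(id_blinfun :: 'h \<Rightarrow>\<^sub>L 'h) \<noteq> 0"
    and spec: "\<And>t. complex_of_real t \<in> spectrum T \<Longrightarrow> t \<in> {a..b}"
begin

lemma norm_op_poly_diff_le:
  assumes "\<And>t. t \<in> {a..b} \<Longrightarrow> \<bar>poly q t - poly r t\<bar> \<le> B"
  shows "norm (op_poly q T - op_poly r T) \<le> B"
  using norm_op_poly_le[OF herm nontrivial, of "q - r" B] assms spec
  by (simp add: op_poly_diff)

lemma fun_calc_LIMSEQ:
  assumes q: "uniform_limit {a..b} (\<lambda>n. poly (q n)) f sequentially"
  shows "(\<lambda>n. op_poly (q n) T) \<longlonglongrightarrow> fun_calc f T"
proof -
  have q': "\<exists>N. \<forall>n\<ge>N. \<forall>t\<in>{a..b}. \<bar>poly (q n) t - f t\<bar> < e" if "e > 0" for e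
    using uniform_limitD[OF q that] unfolding eventually_sequentially dist_real_def .
  have "Cauchy (\<lambda>n. op_poly (q n) T)"
  proof (rule metric_CauchyI)
    fix e :: real assume e: "e > 0"
    then obtain N where N: "\<And>n t. n \<ge> N \<Longrightarrow> t \<in> {a..b} \<Longrightarrow> \<bar>poly (q n) t - f t\<bar> < e / 3"
      using q'[of "e / 3"] by (metis divide_pos_pos zero_less_numeral)
    have "dist (op_poly (q m) T) (op_poly (q n) T) < e" if mn: "m \<ge> N" "n \<ge> N" for m n
    proof -
      have "norm (op_poly (q m) T - op_poly (q n) T) \<le> 2 * e / 3"
      proof (rule norm_op_poly_diff_le)
        fix t assume t: "t \<in> {a..b}"
        show "\<bar>poly (q m) t - poly (q n) t\<bar> \<le> 2 * e / 3"
          using N[OF mn(1) t] N[OF mn(2) t] by linarith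
      qed
      then show ?thesis using e by (simp add: dist_norm)
    qed
    then show "\<exists>N. \<forall>m\<ge>N. \<forall>n\<ge>N. dist (op_poly (q m) T) (op_poly (q n) T) < e" by blast
  qed
  then obtain S where S: "(\<lambda>n. op_poly (q n) T) \<longlonglongrightarrow> S"
    by (auto simp: Cauchy_convergent_iff convergent_def)
  have "fun_calc f T = S"
    unfolding fun_calc_def
  proof (rule the_equality)
    show "\<forall>e>0. \<exists>r. (\<forall>t. complex_of_real t \<in> spectrum T \<longrightarrow> \<bar>poly r t - f t\<bar> < e) \<and>
        norm (op_poly r T - S) < e"
    proof (intro allI impI)
      fix e :: real assume e: "e > 0"
      obtain N where N: "\<And>n t. n \<ge> N \<Longrightarrow> t \<in> {a..b} \<Longrightarrow> \<bar>poly (q n) t - f t\<bar> < e"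
        using q'[OF e] by blast
      obtain M where M: "\<And>n. n \<ge> M \<Longrightarrow> norm (op_poly (q n) T - S) < e"
        using LIMSEQ_D[OF S e] by blast
      show "\<exists>r. (\<forall>t. complex_of_real t \<in> spectrum T \<longrightarrow> \<bar>poly r t - f t\<bar> < e) \<and>
          norm (op_poly r T - S) < e"
        using N[of "max M N"] M[of "max M N"] spec by (intro exI[of _ "q (max M N)"]) simp
    qed
    fix S'
    assume S': "\<forall>e>0. \<exists>r. (\<forall>t. complex_of_real t \<in> spectrum T \<longrightarrow> \<bar>poly r t - f t\<bar> < e) \<and>
        norm (op_poly r T - S') < e"
    have "(\<lambda>n. op_poly (q n) T) \<longlonglongrightarrow> S'"
    proof (rule LIMSEQ_I)
      fix e :: real assume e: "e > 0"
      then have e3: "e / 3 > 0" by simp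
      obtain r where r: "\<And>t. complex_of_real t \<in> spectrum T \<Longrightarrow> \<bar>poly r t - f t\<bar> < e / 3"
        "norm (op_poly r T - S') < e / 3" using S' e3 by blast
      obtain N where N: "\<And>n t. n \<ge> N \<Longrightarrow> t \<in> {a..b} \<Longrightarrow> \<bar>poly (q n) t - f t\<bar> < e / 3"
        using q'[OF e3] by blast
      have "norm (op_poly (q n) T - S') < e" if n: "n \<ge> N" for n
      proof -
        have "norm (op_poly (q n - r) T) \<le> 2 * e / 3"
        proof (rule norm_op_poly_le[OF herm nontrivial])
          fix t assume t: "complex_of_real t \<in> spectrum T"
          have "\<bar>poly (q n) t - poly r t\<bar> \<le> \<bar>poly (q n) t - f t\<bar> + \<bar>poly r t - f t\<bar>"
            by linarith
          then show "\<bar>poly (q n - r) t\<bar> \<le> 2 * e / 3"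
            using N[OF n spec[OF t]] r(1)[OF t] by simp
        qed
        moreover have "op_poly (q n) T - S' = op_poly (q n - r) T + (op_poly r T - S')"
          by (simp add: op_poly_diff)
        then have "norm (op_poly (q n) T - S') \<le> norm (op_poly (q n - r) T) + norm (op_poly r T - S')"
          by (metis norm_triangle_ineq)
        ultimately show ?thesis using r(2) by simp
      qed
      then show "\<exists>N. \<forall>n\<ge>N. norm (op_poly (q n) T - S') < e" by blast
    qed
    then show "S' = S" using S LIMSEQ_unique by blast
  qed
  with S show ?thesis by simp
qed

lemma fun_calc_poly: "fun_calc (poly q) T = op_poly q T"
proof -
  have "uniform_limit {a..b} (\<lambda>n. poly q) (poly q) sequentially"
    by (auto intro!: uniform_limitI)
  from fun_calc_LIMSEQ[OF this] show ?thesis using LIMSEQ_unique tendsto_const by blast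
qed

lemma fun_calc_const: "fun_calc (\<lambda>_. c) T = c *\<^sub>R id_blinfun"
proof -
  have "poly [:c:] = (\<lambda>_. c)" by (intro ext) simp
  then show ?thesis using fun_calc_poly[of "[:c:]"] by (simp add: op_poly_pCons)
qed

lemma fun_calc_ident: "fun_calc (\<lambda>x. x) T = T"
proof -
  have "poly [:0, 1:] = (\<lambda>x :: real. x)" by (intro ext) simp
  then show ?thesis using fun_calc_poly[of "[:0, 1:]"] by (simp add: op_poly_pCons)
qed

lemma fun_calc_cong:
  assumes "continuous_on {a..b} f" "\<And>t. t \<in> {a..b} \<Longrightarrow> f t = g t"
  shows "fun_calc f T = fun_calc g T"
proof -
  obtain q where q: "uniform_limit {a..b} (\<lambda>n. poly (q n)) f sequentially"
    using ex_uniform_limit_poly[OF assms(1)] .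
  then have "uniform_limit {a..b} (\<lambda>n. poly (q n)) g sequentially"
    using uniform_limit_cong'[of "{a..b}" "\<lambda>n. poly (q n)" "\<lambda>n. poly (q n)" f g] assms(2) by simp
  then show ?thesis using fun_calc_LIMSEQ q LIMSEQ_unique by blast
qed

lemma fun_calc_add:
  assumes "continuous_on {a..b} f" "continuous_on {a..b} g"
  shows "fun_calc (\<lambda>t. f t + g t) T = fun_calc f T + fun_calc g T"
proof -
  obtain q r where q: "uniform_limit {a..b} (\<lambda>n. poly (q n)) f sequentially"
    and r: "uniform_limit {a..b} (\<lambda>n. poly (r n)) g sequentially"
    using ex_uniform_limit_poly assms by metis
  have "uniform_limit {a..b} (\<lambda>n. poly (q n + r n)) (\<lambda>t. f t + g t) sequentially"
    using uniform_limit_add[OF q r] unfolding poly_add[symmetric] .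
  from fun_calc_LIMSEQ[OF this] tendsto_add[OF fun_calc_LIMSEQ[OF q] fun_calc_LIMSEQ[OF r]]
  show ?thesis using LIMSEQ_unique by (auto simp: op_poly_add)
qed

lemma fun_calc_mult:
  assumes "continuous_on {a..b} f" "continuous_on {a..b} g"
  shows "fun_calc (\<lambda>t. f t * g t) T = fun_calc f T o\<^sub>L fun_calc g T"
proof -
  obtain q r where q: "uniform_limit {a..b} (\<lambda>n. poly (q n)) f sequentially"
    and r: "uniform_limit {a..b} (\<lambda>n. poly (r n)) g sequentially"
    using ex_uniform_limit_poly assms by metis
  have "bounded (f ` {a..b})" "bounded (g ` {a..b})"
    using assms by (auto intro!: compact_imp_bounded compact_continuous_image)
  then have "uniform_limit {a..b} (\<lambda>n. poly (q n * r n)) (\<lambda>t. f t * g t) sequentially"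
    using bounded_bilinear.bounded_uniform_limit[OF bounded_bilinear_mult q r]
    unfolding poly_mult[symmetric] by blast
  from fun_calc_LIMSEQ[OF this]
    blinfun_compose.tendsto[OF fun_calc_LIMSEQ[OF q] fun_calc_LIMSEQ[OF r]]
  show ?thesis using LIMSEQ_unique by (auto simp: op_poly_mult)
qed

lemma fun_calc_cmult:
  "continuous_on {a..b} f \<Longrightarrow> fun_calc (\<lambda>t. c * f t) T = c *\<^sub>R fun_calc f T"
  by (simp add: fun_calc_mult fun_calc_const op_ring_simps)

lemma fun_calc_diff:
  assumes "continuous_on {a..b} f" "continuous_on {a..b} g"
  shows "fun_calc (\<lambda>t. f t - g t) T = fun_calc f T - fun_calc g T"
  using fun_calc_add[of f "\<lambda>t. -1 * g t"] fun_calc_cmult[of g "-1"] assms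
  by (simp add: continuous_intros)

lemma norm_fun_calc_le:
  assumes "continuous_on {a..b} f" and B: "\<And>t. t \<in> {a..b} \<Longrightarrow> \<bar>f t\<bar> \<le> B"
  shows "norm (fun_calc f T) \<le> B"
proof (rule field_le_epsilon)
  fix e :: real assume e: "e > 0"
  obtain q where q: "uniform_limit {a..b} (\<lambda>n. poly (q n)) f sequentially"
    using ex_uniform_limit_poly[OF assms(1)] .
  have "\<forall>\<^sub>F n in sequentially. norm (op_poly (q n) T) \<le> B + e"
    using uniform_limitD[OF q e]
  proof eventually_elim
    case (elim n)
    show ?case
    proof (rule norm_op_poly_le[OF herm nontrivial])
      fix t assume "complex_of_real t \<in> spectrum T"
      then have "t \<in> {a..b}" by (rule spec)
      with elim B[of t] show "\<bar>poly (q n) t\<bar> \<le> B + e"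
        unfolding dist_real_def by fastforce
    qed
  qed
  then show "norm (fun_calc f T) \<le> B + e"
    using tendsto_upperbound[OF tendsto_norm[OF fun_calc_LIMSEQ[OF q]]] by simp
qed

lemma fun_calc_mem_closed:
  assumes "continuous_on {a..b} f" "closed C" "\<And>q. op_poly q T \<in> C"
  shows "fun_calc f T \<in> C"
proof -
  obtain q where q: "uniform_limit {a..b} (\<lambda>n. poly (q n)) f sequentially"
    using ex_uniform_limit_poly[OF assms(1)] .
  show ?thesis
    using closed_sequentially[OF assms(2) _ fun_calc_LIMSEQ[OF q]] assms(3) by blast
qed

lemma hermitian_fun_calc: "continuous_on {a..b} f \<Longrightarrow> hermitian (fun_calc f T)"
  using fun_calc_mem_closed[OF _ closed_hermitian] hermitian_op_poly[OF herm] by auto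

lemma Re_cinner_fun_calc_nonneg:
  assumes "continuous_on {a..b} f" and "\<And>t. t \<in> {a..b} \<Longrightarrow> 0 \<le> f t"
  shows "0 \<le> Re (cinner x (blinfun_apply (fun_calc f T) x))"
proof -
  have c: "continuous_on {a..b} (\<lambda>t. sqrt (f t))" by (intro continuous_intros assms)
  have "fun_calc f T = fun_calc (\<lambda>t. sqrt (f t) * sqrt (f t)) T"
    by (rule fun_calc_cong) (use assms in auto)
  then have "fun_calc f T = fun_calc (\<lambda>t. sqrt (f t)) T o\<^sub>L fun_calc (\<lambda>t. sqrt (f t)) T"
    by (simp only: fun_calc_mult[OF c c])
  then show ?thesis
    by (simp add: hermitian_norm_sq[OF hermitian_fun_calc[OF c]])
qed

end

lemma spectral_intervalI:
  fixes T :: "'h::chilbert_space \<Rightarrow>\<^sub>L 'h"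
  assumes T: "hermitian T" and nt: "(id_blinfun :: 'h \<Rightarrow>\<^sub>L 'h) \<noteq> 0"
    and a: "\<And>x. a * (norm x)\<^sup>2 \<le> Re (cinner x (blinfun_apply T x))"
    and b: "\<And>x. Re (cinner x (blinfun_apply T x)) \<le> b * (norm x)\<^sup>2"
  shows "spectral_interval T a b"
proof
  fix t assume t: "complex_of_real t \<in> spectrum T"
  have Re: "Re (cinner x (blinfun_apply (T - t *\<^sub>R id_blinfun) x))
      = Re (cinner x (blinfun_apply T x)) - t * (norm x)\<^sup>2" for x
    by (simp add: blinfun.bilinear_simps cinner.diff_right cinner_scaleR_right Re_cinner_self)
  have herm: "hermitian (T - t *\<^sub>R id_blinfun)" by (intro hermitian_closed_under T)
  have inv: "\<not> op_invertible (T - t *\<^sub>R id_blinfun)"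
    using t by (simp add: spectrum_iff_not_invertible scalar_op_of_real)
  show "t \<in> {a..b}"
  proof (rule ccontr)
    assume "t \<notin> {a..b}"
    then consider "a - t > 0" | "t - b > 0" by fastforce
    then show False
    proof cases
      case 1
      have "(a - t) * (norm x)\<^sup>2 \<le> \<bar>Re (cinner x (blinfun_apply (T - t *\<^sub>R id_blinfun) x))\<bar>" for x
        unfolding Re left_diff_distrib using a[of x] by linarith
      with hermitian_invertible[OF herm 1] inv show False by blast
    next
      case 2
      have "(t - b) * (norm x)\<^sup>2 \<le> \<bar>Re (cinner x (blinfun_apply (T - t *\<^sub>R id_blinfun) x))\<bar>" for x
        unfolding Re left_diff_distrib using b[of x] by linarith
      with hermitian_invertible[OF herm 2] inv show False by blast
    qed
  qed
qed (use assms in auto)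

context spectral_interval
begin

lemma spectral_interval_fun_calc:
  assumes f: "continuous_on {a..b} f" and cd: "\<And>t. t \<in> {a..b} \<Longrightarrow> f t \<in> {c..d}"
  shows "spectral_interval (fun_calc f T) c d"
proof (rule spectral_intervalI[OF hermitian_fun_calc[OF f] nontrivial])
  fix x
  have c1: "continuous_on {a..b} (\<lambda>t. f t - c)" "continuous_on {a..b} (\<lambda>t. d - f t)"
    by (intro continuous_intros f)+
  have "0 \<le> Re (cinner x (blinfun_apply (fun_calc (\<lambda>t. f t - c) T) x))"
    "0 \<le> Re (cinner x (blinfun_apply (fun_calc (\<lambda>t. d - f t) T) x))"
    using cd by (auto intro!: Re_cinner_fun_calc_nonneg c1)
  then show "c * (norm x)\<^sup>2 \<le> Re (cinner x (blinfun_apply (fun_calc f T) x))"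
    "Re (cinner x (blinfun_apply (fun_calc f T) x)) \<le> d * (norm x)\<^sup>2"
    by (simp_all add: fun_calc_diff[OF f continuous_on_const] fun_calc_diff[OF continuous_on_const f]
        fun_calc_const blinfun.bilinear_simps cinner.diff_right cinner_scaleR_right Re_cinner_self)
qed

lemma fun_calc_compose:
  assumes f: "continuous_on {a..b} f" and cd: "\<And>t. t \<in> {a..b} \<Longrightarrow> f t \<in> {c..d}"
    and g: "continuous_on {c..d} g"
  shows "fun_calc g (fun_calc f T) = fun_calc (\<lambda>t. g (f t)) T"
proof -
  interpret F: spectral_interval "fun_calc f T" c d
    by (rule spectral_interval_fun_calc[OF f cd])
  have poly: "op_poly q (fun_calc f T) = fun_calc (\<lambda>t. poly q (f t)) T" for q
  proof (induction q)
    case 0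
    then show ?case by (simp add: fun_calc_const)
  next
    case (pCons e q)
    have "continuous_on {a..b} (\<lambda>t. poly q (f t))" by (intro continuous_intros f)
    with f show ?case
      by (simp add: pCons op_poly_pCons fun_calc_add fun_calc_mult fun_calc_const continuous_on_mult)
  qed
  have gf: "continuous_on {a..b} (\<lambda>t. g (f t))"
    by (rule continuous_on_compose2[OF g f]) (use cd in auto)
  obtain q where q: "uniform_limit {c..d} (\<lambda>n. poly (q n)) g sequentially"
    using ex_uniform_limit_poly[OF g] .
  have "(\<lambda>n. op_poly (q n) (fun_calc f T)) \<longlonglongrightarrow> fun_calc (\<lambda>t. g (f t)) T"
  proof (rule LIMSEQ_I)
    fix e :: real assume e: "e > 0"
    then have "e / 2 > 0" by simp
    from uniform_limitD[OF q this] obtain N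
      where N: "\<And>n s. n \<ge> N \<Longrightarrow> s \<in> {c..d} \<Longrightarrow> dist (poly (q n) s) (g s) < e / 2"
      unfolding eventually_sequentially by blast
    have "norm (op_poly (q n) (fun_calc f T) - fun_calc (\<lambda>t. g (f t)) T) < e" if n: "n \<ge> N" for n
    proof -
      have c1: "continuous_on {a..b} (\<lambda>t. poly (q n) (f t))" by (intro continuous_intros f)
      have "norm (fun_calc (\<lambda>t. poly (q n) (f t) - g (f t)) T) \<le> e / 2"
      proof (rule norm_fun_calc_le)
        show "\<bar>poly (q n) (f t) - g (f t)\<bar> \<le> e / 2" if "t \<in> {a..b}" for t
          using N[OF n cd[OF that]] by (simp add: dist_real_def)
      qed (intro continuous_intros c1 gf)
      then show ?thesis using e by (simp add: poly fun_calc_diff[OF c1 gf])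
    qed
    then show "\<exists>N. \<forall>n\<ge>N. norm (op_poly (q n) (fun_calc f T) - fun_calc (\<lambda>t. g (f t)) T) < e"
      by blast
  qed
  with F.fun_calc_LIMSEQ[OF q] show ?thesis using LIMSEQ_unique by blast
qed

end

section \<open>Power inequalities and the trace\<close>

lemma powr_less_tangent:
  fixes u q :: real
  assumes u: "u \<ge> 0" "u \<noteq> 1" and q: "0 < q" "q < 1"
  shows "u powr q < 1 + q * (u - 1)"
proof (cases "u = 0")
  case False
  define m where "m = 1 + q * (u - 1)"
  have "0 \<le> q * u" using u q by simp
  then have m0: "m > 0" unfolding m_def right_diff_distrib using q by linarith
  have m1: "m \<noteq> 1" using u q by (simp add: m_def)
  have "ln (1 / m) < 1 / m - 1"
    using ln_le_minus_one[of "1 / m"] ln_eq_minus_one[of "1 / m"] m0 m1 by fastforce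
  then have 1: "(1 - q) * ln (1 / m) < (1 - q) * (1 / m - 1)" using q by simp
  have "ln (u / m) \<le> u / m - 1" using ln_le_minus_one[of "u / m"] u m0 False by simp
  then have 2: "q * ln (u / m) \<le> q * (u / m - 1)" using q by simp
  have "q * (u / m - 1) + (1 - q) * (1 / m - 1) = (1 + q * (u - 1)) / m - 1"
    using m0 by (simp add: field_simps)
  also have "\<dots> = 0" using m0 by (simp add: m_def)
  finally have "q * ln (u / m) + (1 - q) * ln (1 / m) < 0" using 1 2 by linarith
  then have "q * ln u < ln m" using u m0 False by (simp add: ln_div algebra_simps)
  then have "exp (q * ln u) < exp (ln m)" by (simp only: exp_less_mono)
  also have "exp (ln m) = m" using m0 by simp
  finally show ?thesis using False by (simp add: powr_def m_def)
qed (use q in simp)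

lemma powr_greater_tangent:
  fixes u q :: real
  assumes u: "u \<ge> 0" "u \<noteq> 1" and q: "1 < q"
  shows "1 + q * (u - 1) < u powr q"
proof (cases "u = 0 \<or> 1 + q * (u - 1) \<le> 0")
  case True
  then show ?thesis
  proof (cases "u = 0")
    case False
    then have "1 + q * (u - 1) \<le> 0" "0 < u powr q" using True u by auto
    then show ?thesis by (rule le_less_trans)
  qed (use q in simp)
next
  case False
  define w where "w = 1 + q * (u - 1)"
  have w: "w > 0" "w \<noteq> 1" using False u q by (auto simp: w_def)
  have "w powr (1 / q) < 1 + (1 / q) * (w - 1)"
    by (rule powr_less_tangent) (use w q in auto)
  also have "\<dots> = u" using q by (simp add: w_def)
  finally have "(w powr (1 / q)) powr q < u powr q"
    using q by (intro powr_less_mono2) auto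
  then show ?thesis using w q by (simp add: powr_powr w_def)
qed

text \<open>The powers of \<open>a\<close> and \<open>c - a\<close> normalise the two summands so that their tangents at
  \<open>t = a\<close> add up to the constant \<open>c\<close>.\<close>

lemma powr_pair_pos:
  fixes a c t q :: real
  assumes a: "0 < a" "a < c" and t: "t \<in> {0..c}" "t \<noteq> a" and q: "0 < q" "q \<noteq> 1"
  shows "0 < sgn (q - 1) * (a powr (1 - q) * t powr q + (c - a) powr (1 - q) * (c - t) powr q - c)"
proof -
  define u v where "u = t / a" and "v = (c - t) / (c - a)"
  have u: "u \<ge> 0" "u \<noteq> 1" and v: "v \<ge> 0" "v \<noteq> 1" using a t by (auto simp: u_def v_def)
  have e1: "x powr (1 - q) * s powr q = x * (s / x) powr q" if "x > 0" "s \<ge> 0" for x s :: real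
    using that by (simp add: powr_divide powr_diff)
  have e: "a powr (1 - q) * t powr q + (c - a) powr (1 - q) * (c - t) powr q - c
      = a * u powr q + (c - a) * v powr q - c"
    unfolding u_def v_def using e1[of a t] e1[of "c - a" "c - t"] a t by simp
  have au: "a * u = t" "(c - a) * v = c - t" using a by (simp_all add: u_def v_def)
  have "a * (1 + q * (u - 1)) + (c - a) * (1 + q * (v - 1)) = c + q * (a * u + (c - a) * v - c)"
    by (simp add: algebra_simps)
  then have z: "a * (1 + q * (u - 1)) + (c - a) * (1 + q * (v - 1)) = c" by (simp add: au)
  show ?thesis
  proof (cases "q < 1")
    case True
    have "a * u powr q + (c - a) * v powr q < a * (1 + q * (u - 1)) + (c - a) * (1 + q * (v - 1))"
      using powr_less_tangent[OF u q(1) True] powr_less_tangent[OF v q(1) True] a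
      by (intro add_strict_mono mult_strict_left_mono) auto
    then show ?thesis using True z by (simp add: e)
  next
    case False
    with q have q1: "1 < q" by simp
    have "a * (1 + q * (u - 1)) + (c - a) * (1 + q * (v - 1)) < a * u powr q + (c - a) * v powr q"
      using powr_greater_tangent[OF u q1] powr_greater_tangent[OF v q1] a
      by (intro add_strict_mono mult_strict_left_mono) auto
    then show ?thesis using q1 z by (simp add: e)
  qed
qed

lemma powr_sum_pos:
  fixes c t q :: real
  assumes t: "0 < t" "t < c" and q: "0 < q" "q \<noteq> 1"
  shows "0 < sgn (1 - q) * (t powr q + (c - t) powr q - c powr q)"
proof -
  have c: "c > 0" using t by simp
  define v where "v = t / c"
  have v: "0 < v" "v < 1" using t by (auto simp: v_def)
  have tv: "t = c * v" "c - t = c * (1 - v)" using c by (simp_all add: v_def field_simps)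
  have "t powr q = c powr q * v powr q" unfolding tv(1) using c v powr_mult[of c v q] by simp
  moreover have "(c - t) powr q = c powr q * (1 - v) powr q"
    unfolding tv(2) using c v powr_mult[of c "1 - v" q] by simp
  ultimately have eq: "t powr q + (c - t) powr q - c powr q = c powr q * (v powr q + (1 - v) powr q - 1)"
    by (simp add: algebra_simps)
  have v_pos: "0 < sgn (1 - q) * (v powr q + (1 - v) powr q - 1)"
  proof (cases "q < 1")
    case True
    then have "v powr 1 < v powr q" "(1 - v) powr 1 < (1 - v) powr q"
      using v by (intro powr_less_mono'; simp)+
    then show ?thesis using True v by simp
  next
    case False
    then have "v powr q < v powr 1" "(1 - v) powr q < (1 - v) powr 1"
      using v q by (intro powr_less_mono'; simp)+
    then show ?thesis using False q v by simp
  qed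
  have "0 < c powr q" using c by simp
  from mult_pos_pos[OF this v_pos] show ?thesis by (simp only: eq mult.left_commute)
qed

lemma continuous_domination:
  fixes h k :: "real \<Rightarrow> real"
  assumes h: "continuous_on {a..b} h" and k: "continuous_on {a..b} k"
    and h0: "\<And>t. t \<in> {a..b} \<Longrightarrow> 0 \<le> h t"
    and hk: "\<And>t. t \<in> {a..b} \<Longrightarrow> h t = 0 \<Longrightarrow> k t = 0" and e: "e > 0"
  shows "\<exists>C. \<forall>t\<in>{a..b}. k t \<le> e + C * h t"
proof -
  define S where "S = {t \<in> {a..b}. e \<le> k t}"
  have Seq: "S = {a..b} \<inter> k -` {e..}" by (auto simp: S_def)
  have "closed S" unfolding Seq
    by (rule continuous_closed_preimage[OF k closed_real_atLeastAtMost closed_atLeast])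
  moreover have "bounded S" unfolding Seq by (rule bounded_subset[OF bounded_closed_interval]) auto
  ultimately have S: "compact S" by (simp add: compact_eq_bounded_closed)
  have Sab: "S \<subseteq> {a..b}" by (auto simp: S_def)
  show ?thesis
  proof (cases "S = {}")
    case True
    then have "\<forall>t\<in>{a..b}. k t \<le> e + 0 * h t" by (force simp: S_def)
    then show ?thesis by blast
  next
    case False
    obtain s where s: "s \<in> S" "\<And>t. t \<in> S \<Longrightarrow> h s \<le> h t"
      using continuous_attains_inf[OF S False continuous_on_subset[OF h Sab]] by blast
    obtain r where r: "\<And>t. t \<in> S \<Longrightarrow> k t \<le> k r"
      using continuous_attains_sup[OF S False continuous_on_subset[OF k Sab]] by blast
    have "h s \<noteq> 0" using s(1) hk[of s] e by (auto simp: S_def)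
    then have hs: "h s > 0" using s(1) h0[of s] Sab by force
    have "k t \<le> e + \<bar>k r\<bar> / h s * h t" if t: "t \<in> {a..b}" for t
    proof (cases "t \<in> S")
      case True
      have "\<bar>k r\<bar> * h s \<le> \<bar>k r\<bar> * h t" by (intro mult_left_mono s(2)[OF True]) simp
      then have "\<bar>k r\<bar> \<le> \<bar>k r\<bar> / h s * h t" using hs by (simp add: field_simps)
      with r[OF True] e show ?thesis by linarith
    next
      case False
      then have "k t \<le> e" using t by (simp add: S_def)
      moreover have "0 \<le> \<bar>k r\<bar> / h s * h t" using hs h0[OF t] by simp
      ultimately show ?thesis by linarith
    qed
    then show ?thesis by blast
  qed
qed

lemma commutant_closed_under:
  fixes S :: "('h::chilbert_space \<Rightarrow>\<^sub>L 'h) set"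
  assumes S: "S \<subseteq> bounded_ops"
  shows "id_blinfun \<in> commutant S" "scalar_op c \<in> commutant S"
    "A \<in> commutant S \<Longrightarrow> B \<in> commutant S \<Longrightarrow> A + B \<in> commutant S"
    "A \<in> commutant S \<Longrightarrow> B \<in> commutant S \<Longrightarrow> A o\<^sub>L B \<in> commutant S"
    "A \<in> commutant S \<Longrightarrow> r *\<^sub>R A \<in> commutant S"
    "closed (commutant S)"
proof -
  show "scalar_op c \<in> commutant S" "id_blinfun \<in> commutant S"
    using S by (auto simp: commutant_def scalar_op_commute)
  show "A \<in> commutant S \<Longrightarrow> B \<in> commutant S \<Longrightarrow> A + B \<in> commutant S"
    "A \<in> commutant S \<Longrightarrow> r *\<^sub>R A \<in> commutant S"
    by (auto simp: commutant_def op_ring_simps)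
  show "A o\<^sub>L B \<in> commutant S" if "A \<in> commutant S" "B \<in> commutant S"
  proof -
    have "(A o\<^sub>L B) o\<^sub>L C = C o\<^sub>L (A o\<^sub>L B)" if "C \<in> S" for C
    proof -
      have "A o\<^sub>L C = C o\<^sub>L A" "B o\<^sub>L C = C o\<^sub>L B"
        using \<open>A \<in> commutant S\<close> \<open>B \<in> commutant S\<close> that by (auto simp: commutant_def)
      then show ?thesis by (metis blinfun_compose_assoc)
    qed
    with that show ?thesis by (auto simp: commutant_def)
  qed
  show "closed (commutant S)"
    unfolding closed_sequential_limits
  proof (intro allI impI, elim conjE)
    fix X and l :: "'h \<Rightarrow>\<^sub>L 'h" assume X: "\<forall>n. X n \<in> commutant S" and l: "X \<longlonglongrightarrow> l"
    have "l \<in> bounded_ops"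
      by (rule closed_sequentially[OF closed_bounded_ops _ l]) (use X in \<open>simp add: commutant_def\<close>)
    moreover have "l o\<^sub>L C = C o\<^sub>L l" if C: "C \<in> S" for C
    proof -
      have "(\<lambda>n. X n o\<^sub>L C) \<longlonglongrightarrow> (l o\<^sub>L C)" "(\<lambda>n. C o\<^sub>L X n) \<longlonglongrightarrow> (C o\<^sub>L l)"
        by (intro blinfun_compose.tendsto l tendsto_const)+
      moreover have "X n o\<^sub>L C = C o\<^sub>L X n" for n using X C by (simp add: commutant_def)
      ultimately show ?thesis using LIMSEQ_unique by simp
    qed
    ultimately show "l \<in> commutant S" by (simp add: commutant_def)
  qed
qed

locale tracial_algebra =
  fixes N :: "('h::chilbert_space \<Rightarrow>\<^sub>L 'h) set" and \<tau> :: "('h \<Rightarrow>\<^sub>L 'h) \<Rightarrow> complex"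
  assumes vN: "von_neumann_algebra N"
    and nontrivial: "(id_blinfun :: 'h \<Rightarrow>\<^sub>L 'h) \<noteq> 0"
    and trace: "faithful_tracial_state N \<tau>"
begin

lemma N_bounded_ops: "A \<in> N \<Longrightarrow> A \<in> bounded_ops"
  using vN by (auto simp: von_neumann_algebra_def)

lemma commutant_bounded_ops: "commutant N \<subseteq> bounded_ops"
  by (auto simp: commutant_def)

lemma N_eq: "commutant (commutant N) = N"
  using vN by (simp add: von_neumann_algebra_def)

lemma N_closed_under:
  "id_blinfun \<in> N" "scalar_op c \<in> N"
  "A \<in> N \<Longrightarrow> B \<in> N \<Longrightarrow> A + B \<in> N" "A \<in> N \<Longrightarrow> B \<in> N \<Longrightarrow> A o\<^sub>L B \<in> N"
  "A \<in> N \<Longrightarrow> r *\<^sub>R A \<in> N" "closed N"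
  using commutant_closed_under[OF commutant_bounded_ops] by (simp_all add: N_eq)

lemma N_adj: "A \<in> N \<Longrightarrow> adj A \<in> N"
  using vN by (simp add: von_neumann_algebra_def)

lemma N_zero: "0 \<in> N"
  using N_closed_under(5)[OF N_closed_under(1), of 0] by simp

lemma N_minus: "A \<in> N \<Longrightarrow> - A \<in> N"
  using N_closed_under(5)[of A "-1"] by simp

lemma N_diff: "A \<in> N \<Longrightarrow> B \<in> N \<Longrightarrow> A - B \<in> N"
  using N_closed_under(3)[OF _ N_minus, of A B] by simp

lemma N_op_poly: "T \<in> N \<Longrightarrow> op_poly q T \<in> N"
  by (induction q) (auto simp: op_poly_pCons N_zero intro!: N_closed_under)

lemma N_inverse:
  assumes A: "A \<in> N" and S: "S \<in> bounded_ops" "S o\<^sub>L A = id_blinfun" "A o\<^sub>L S = id_blinfun"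
  shows "S \<in> N"
proof -
  have "S o\<^sub>L B = B o\<^sub>L S" if "B \<in> commutant N" for B
  proof -
    have "B o\<^sub>L A = A o\<^sub>L B" using that A by (simp add: commutant_def)
    then have "S o\<^sub>L (A o\<^sub>L B) o\<^sub>L S = S o\<^sub>L (B o\<^sub>L A) o\<^sub>L S" by simp
    then have "(S o\<^sub>L A) o\<^sub>L (B o\<^sub>L S) = (S o\<^sub>L B) o\<^sub>L (A o\<^sub>L S)"
      by (simp only: blinfun_compose_assoc)
    then show ?thesis using S by simp
  qed
  with S(1) have "S \<in> commutant (commutant N)" by (simp add: commutant_def)
  then show ?thesis by (simp add: N_eq)
qed

lemma trace_add: "A \<in> N \<Longrightarrow> B \<in> N \<Longrightarrow> \<tau> (A + B) = \<tau> A + \<tau> B"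
  using trace by (simp add: faithful_tracial_state_def)

lemma trace_scaleR: "A \<in> N \<Longrightarrow> \<tau> (r *\<^sub>R A) = r *\<^sub>R \<tau> A"
proof -
  assume "A \<in> N"
  then have "\<tau> (scalar_op (complex_of_real r) o\<^sub>L A) = complex_of_real r * \<tau> A"
    using trace by (simp add: faithful_tracial_state_def)
  then show ?thesis by (simp add: scalar_op_of_real op_ring_simps scaleR_conv_of_real)
qed

lemma trace_id: "\<tau> id_blinfun = 1"
  using trace by (simp add: faithful_tracial_state_def)

lemma trace_nonneg: "A \<in> N \<Longrightarrow> 0 \<le> Re (\<tau> (adj A o\<^sub>L A))"
  using trace by (simp add: faithful_tracial_state_def)

lemma trace_faithful:
  assumes "A \<in> N" "Re (\<tau> (adj A o\<^sub>L A)) = 0"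
  shows "A = 0"
proof -
  have "\<tau> (adj A o\<^sub>L A) \<in> \<real>" using trace assms(1) by (simp add: faithful_tracial_state_def)
  then have "\<tau> (adj A o\<^sub>L A) = 0" using assms(2) by (auto simp: complex_is_Real_iff complex_eq_iff)
  then show ?thesis using trace assms(1) by (simp add: faithful_tracial_state_def)
qed

lemma N_fun_calc:
  "spectral_interval T a b \<Longrightarrow> T \<in> N \<Longrightarrow> continuous_on {a..b} f \<Longrightarrow> fun_calc f T \<in> N"
  by (rule spectral_interval.fun_calc_mem_closed) (auto intro: N_closed_under N_op_poly)

lemma spectral_interval_adj_compose:
  assumes A: "A \<in> N" and b: "\<And>x. (norm (blinfun_apply A x))\<^sup>2 \<le> b * (norm x)\<^sup>2"
  shows "spectral_interval (adj A o\<^sub>L A) 0 b"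
proof (rule spectral_intervalI[OF _ nontrivial])
  have A': "A \<in> bounded_ops" using A by (rule N_bounded_ops)
  then show "hermitian (adj A o\<^sub>L A)"
    by (simp add: hermitian_def adj_compose adj_adj)
  have "Re (cinner x (blinfun_apply (adj A o\<^sub>L A) x)) = (norm (blinfun_apply A x))\<^sup>2" for x
    by (simp add: cinner_adj_right[OF A'] Re_cinner_self)
  then show "0 * (norm x)\<^sup>2 \<le> Re (cinner x (blinfun_apply (adj A o\<^sub>L A) x))"
    "Re (cinner x (blinfun_apply (adj A o\<^sub>L A) x)) \<le> b * (norm x)\<^sup>2" for x
    using b by simp_all
qed

end

locale tracial_operator = tracial_algebra N \<tau> + spectral_interval T a b
  for N :: "('h::chilbert_space \<Rightarrow>\<^sub>L 'h) set" and \<tau> T a b +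
  assumes T_in_N: "T \<in> N"
begin

definition mean :: "(real \<Rightarrow> real) \<Rightarrow> real"
  where "mean f = Re (\<tau> (fun_calc f T))"

lemma fun_calc_in_N: "continuous_on {a..b} f \<Longrightarrow> fun_calc f T \<in> N"
  using N_fun_calc[OF spectral_interval_axioms T_in_N] .

lemma mean_add:
  "continuous_on {a..b} f \<Longrightarrow> continuous_on {a..b} g \<Longrightarrow> mean (\<lambda>t. f t + g t) = mean f + mean g"
  by (simp add: mean_def fun_calc_add trace_add fun_calc_in_N)

lemma mean_cmult: "continuous_on {a..b} f \<Longrightarrow> mean (\<lambda>t. c * f t) = c * mean f"
  by (simp add: mean_def fun_calc_cmult trace_scaleR fun_calc_in_N)

lemma mean_const: "mean (\<lambda>_. c) = c"
  by (simp add: mean_def fun_calc_const trace_scaleR trace_id N_closed_under)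

lemma mean_diff:
  assumes "continuous_on {a..b} f" "continuous_on {a..b} g"
  shows "mean (\<lambda>t. f t - g t) = mean f - mean g"
  using mean_add[of f "\<lambda>t. -1 * g t"] mean_cmult[of g "-1"] assms by (simp add: continuous_intros)

lemma mean_square:
  assumes "continuous_on {a..b} f"
  shows "mean (\<lambda>t. f t * f t) = Re (\<tau> (adj (fun_calc f T) o\<^sub>L fun_calc f T))"
  using hermitianD(2)[OF hermitian_fun_calc[OF assms]] by (simp add: mean_def fun_calc_mult assms)

lemma mean_cong:
  "continuous_on {a..b} f \<Longrightarrow> (\<And>t. t \<in> {a..b} \<Longrightarrow> f t = g t) \<Longrightarrow> mean f = mean g"
  by (simp only: mean_def fun_calc_cong)

lemma mean_nonneg:
  assumes f: "continuous_on {a..b} f" and "\<And>t. t \<in> {a..b} \<Longrightarrow> 0 \<le> f t"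
  shows "0 \<le> mean f"
proof -
  have c: "continuous_on {a..b} (\<lambda>t. sqrt (f t))" by (intro continuous_intros f)
  have "mean f = mean (\<lambda>t. sqrt (f t) * sqrt (f t))"
    by (rule mean_cong[OF f]) (use assms in auto)
  then show ?thesis
    by (simp only: mean_square[OF c] trace_nonneg[OF fun_calc_in_N[OF c]])
qed

lemma mean_mono:
  assumes "continuous_on {a..b} f" "continuous_on {a..b} g" "\<And>t. t \<in> {a..b} \<Longrightarrow> f t \<le> g t"
  shows "mean f \<le> mean g"
  using mean_nonneg[of "\<lambda>t. g t - f t"] mean_diff[of g f] assms by (simp add: continuous_intros)

lemma fun_calc_eq_0:
  assumes h: "continuous_on {a..b} h" "\<And>t. t \<in> {a..b} \<Longrightarrow> 0 \<le> h t" "mean h = 0"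
    and k: "continuous_on {a..b} k" "\<And>t. t \<in> {a..b} \<Longrightarrow> h t = 0 \<Longrightarrow> k t = 0"
  shows "fun_calc k T = 0"
proof -
  have k2: "continuous_on {a..b} (\<lambda>t. k t * k t)" by (intro continuous_intros k)
  have "mean (\<lambda>t. k t * k t) \<le> 0 + e" if e: "e > 0" for e
  proof -
    obtain C where C: "\<And>t. t \<in> {a..b} \<Longrightarrow> k t * k t \<le> e + C * h t"
      using continuous_domination[OF h(1) k2 h(2) _ e] k(2) by fastforce
    have c: "continuous_on {a..b} (\<lambda>t. C * h t)" by (intro continuous_intros h)
    have "mean (\<lambda>t. k t * k t) \<le> mean (\<lambda>t. e + C * h t)"
      by (intro mean_mono k2 C continuous_on_add c continuous_on_const)
    also have "\<dots> = e" using h by (simp add: mean_add[OF continuous_on_const c] mean_const mean_cmult)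
    finally show ?thesis by simp
  qed
  then have "mean (\<lambda>t. k t * k t) \<le> 0" by (rule field_le_epsilon)
  moreover have "0 \<le> mean (\<lambda>t. k t * k t)" by (rule mean_nonneg[OF k2]) simp
  ultimately have "Re (\<tau> (adj (fun_calc k T) o\<^sub>L fun_calc k T)) = 0"
    by (simp add: mean_square[OF k(1)])
  then show ?thesis by (rule trace_faithful[OF fun_calc_in_N[OF k(1)]])
qed

lemma mean_eq_0:
  assumes "continuous_on {a..b} h" "\<And>t. t \<in> {a..b} \<Longrightarrow> 0 \<le> h t" "mean h = 0"
    and "continuous_on {a..b} k" "\<And>t. t \<in> {a..b} \<Longrightarrow> h t = 0 \<Longrightarrow> k t = 0"
  shows "mean k = 0"
proof -
  have "fun_calc k T = 0" by (rule fun_calc_eq_0[of h]) (use assms in auto)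
  then show ?thesis using trace_scaleR[OF N_zero, of 0] by (simp add: mean_def)
qed

end

section \<open>Distances between unitaries\<close>

lemma continuous_on_powr_const:
  fixes f :: "real \<Rightarrow> real"
  assumes "continuous_on S f" "\<And>t. t \<in> S \<Longrightarrow> 0 \<le> f t" "p > 0"
  shows "continuous_on S (\<lambda>t. f t powr p)"
  using assms by (intro continuous_on_powr' continuous_on_const) auto

context tracial_algebra
begin

lemma Lp_norm_eq:
  assumes A: "A \<in> N" and S: "spectral_interval (adj A o\<^sub>L A) 0 b" and p: "p > 0"
  shows "Lp_norm \<tau> p A = Re (\<tau> (fun_calc (\<lambda>t. t powr (p / 2)) (adj A o\<^sub>L A))) powr (1 / p)"
proof -
  interpret S: spectral_interval "adj A o\<^sub>L A" 0 b by fact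
  have s: "continuous_on {0..b} sqrt" by (intro continuous_intros)
  have pw: "continuous_on {0..sqrt b} (\<lambda>t. t powr p)"
    by (rule continuous_on_powr_const[OF continuous_on_id _ p]) simp
  have "op_powr (op_abs A) p = fun_calc (\<lambda>t. sqrt t powr p) (adj A o\<^sub>L A)"
    unfolding op_powr_def op_abs_def
    by (rule S.fun_calc_compose[OF s _ pw]) simp
  also have "\<dots> = fun_calc (\<lambda>t. t powr (p / 2)) (adj A o\<^sub>L A)"
  proof (rule S.fun_calc_cong)
    show "continuous_on {0..b} (\<lambda>t. sqrt t powr p)"
      using p by (intro continuous_on_powr_const s) auto
    show "sqrt t powr p = t powr (p / 2)" if "t \<in> {0..b}" for t
      using that by (simp add: powr_half_sqrt[symmetric] powr_powr)
  qed
  finally show ?thesis by (simp add: Lp_norm_def)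
qed

lemma unitaryD:
  assumes "U \<in> unitary_group N"
  shows "U \<in> N" "adj U \<in> N" "U \<in> bounded_ops" "adj U o\<^sub>L U = id_blinfun" "U o\<^sub>L adj U = id_blinfun"
  using assms N_adj N_bounded_ops by (auto simp: unitary_group_def)

lemma norm_unitary:
  assumes "U \<in> unitary_group N"
  shows "norm (blinfun_apply U x) = norm x"
proof -
  have "(norm (blinfun_apply U x))\<^sup>2 = Re (cinner x (blinfun_apply (adj U o\<^sub>L U) x))"
    by (simp add: cinner_adj_right[OF unitaryD(3)[OF assms]] Re_cinner_self)
  then show ?thesis by (simp add: unitaryD[OF assms] Re_cinner_self)
qed

lemma unitary_minus: "U \<in> unitary_group N \<Longrightarrow> - U \<in> unitary_group N"
  by (auto simp: unitary_group_def N_minus adj_minus[OF N_bounded_ops] op_ring_simps)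

definition gap :: "('h \<Rightarrow>\<^sub>L 'h) \<Rightarrow> ('h \<Rightarrow>\<^sub>L 'h) \<Rightarrow> 'h \<Rightarrow>\<^sub>L 'h"
  where "gap U V = adj (U - V) o\<^sub>L (U - V)"

lemma gap_eq:
  assumes U: "U \<in> unitary_group N" and V: "V \<in> unitary_group N"
  shows "gap U V = 2 *\<^sub>R id_blinfun - ((adj U o\<^sub>L V) + (adj V o\<^sub>L U))"
proof -
  have "gap U V = id_blinfun + id_blinfun - ((adj U o\<^sub>L V) + (adj V o\<^sub>L U))"
    using unitaryD[OF U] unitaryD[OF V] by (simp add: gap_def adj_diff op_ring_simps algebra_simps)
  then show ?thesis by (simp add: scaleR_2)
qed

lemma gap_minus:
  assumes U: "U \<in> unitary_group N" and V: "V \<in> unitary_group N"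
  shows "gap U (- V) = 4 *\<^sub>R id_blinfun - gap U V"
proof -
  have "gap U (- V) = 2 *\<^sub>R id_blinfun + ((adj U o\<^sub>L V) + (adj V o\<^sub>L U))"
    using unitaryD[OF V] by (simp add: gap_eq U V unitary_minus adj_minus op_ring_simps)
  then have "gap U (- V) = 4 *\<^sub>R id_blinfun - (4 - 2) *\<^sub>R id_blinfun + ((adj U o\<^sub>L V) + (adj V o\<^sub>L U))"
    by (simp only: scaleR_diff_left) simp
  then show ?thesis by (simp add: gap_eq U V)
qed

lemma tracial_operator_gap:
  assumes U: "U \<in> unitary_group N" and V: "V \<in> unitary_group N"
  shows "tracial_operator N \<tau> (gap U V) 0 4"
proof -
  have UV: "U - V \<in> N" by (intro N_diff unitaryD[OF U] unitaryD[OF V])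
  have "(norm (blinfun_apply (U - V) x))\<^sup>2 \<le> 4 * (norm x)\<^sup>2" for x
  proof -
    have "norm (blinfun_apply (U - V) x) \<le> norm x + norm x"
      using norm_triangle_ineq4[of "blinfun_apply U x" "blinfun_apply V x"]
      by (simp add: blinfun.diff_left norm_unitary[OF U] norm_unitary[OF V])
    then have "(norm (blinfun_apply (U - V) x))\<^sup>2 \<le> (2 * norm x)\<^sup>2" by (intro power_mono) auto
    then show ?thesis by (simp add: power_mult_distrib)
  qed
  then have "spectral_interval (gap U V) 0 4"
    unfolding gap_def by (rule spectral_interval_adj_compose[OF UV])
  moreover have "gap U V \<in> N" unfolding gap_def using UV by (intro N_closed_under N_adj)
  ultimately show ?thesis
    by (simp add: tracial_operator_def tracial_operator_axioms_def tracial_algebra_axioms)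
qed

lemma Lp_norm_gap:
  assumes U: "U \<in> unitary_group N" and V: "V \<in> unitary_group N" and p: "p > 0"
  shows "Lp_norm \<tau> p (U - V) powr p = tracial_operator.mean \<tau> (gap U V) (\<lambda>t. t powr (p / 2))"
    "Lp_norm \<tau> p (U + V) powr p = tracial_operator.mean \<tau> (gap U V) (\<lambda>t. (4 - t) powr (p / 2))"
proof -
  interpret G: tracial_operator N \<tau> "gap U V" 0 4 by (rule tracial_operator_gap[OF U V])
  have c: "continuous_on {0..4} (\<lambda>t :: real. t powr (p / 2))"
    using p by (intro continuous_on_powr_const continuous_intros) auto
  have c4: "continuous_on {0..4} (\<lambda>t :: real. (4 - t) powr (p / 2))"
    using p by (intro continuous_on_powr_const continuous_intros) auto
  have powr_cancel: "(m powr (1 / p)) powr p = m" if "m \<ge> 0" for m :: real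
    using that p by (simp add: powr_powr)
  have "Lp_norm \<tau> p (U - V) = G.mean (\<lambda>t. t powr (p / 2)) powr (1 / p)"
    using Lp_norm_eq[OF N_diff[OF unitaryD(1)[OF U] unitaryD(1)[OF V]]
        G.spectral_interval_axioms[unfolded gap_def] p]
    unfolding G.mean_def by (simp add: gap_def)
  then show "Lp_norm \<tau> p (U - V) powr p = G.mean (\<lambda>t. t powr (p / 2))"
    by (simp only: powr_cancel[OF G.mean_nonneg[OF c]] powr_ge_zero)
  have V': "- V \<in> unitary_group N" by (rule unitary_minus[OF V])
  interpret H: tracial_operator N \<tau> "gap U (- V)" 0 4 by (rule tracial_operator_gap[OF U V'])
  have "fun_calc (\<lambda>t. 4 - t) (gap U V) = gap U (- V)"
    by (simp add: gap_minus[OF U V] G.fun_calc_diff continuous_intros G.fun_calc_const G.fun_calc_ident)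
  then have "fun_calc (\<lambda>t. t powr (p / 2)) (gap U (- V)) = fun_calc (\<lambda>t. (4 - t) powr (p / 2)) (gap U V)"
    using G.fun_calc_compose[of "\<lambda>t. 4 - t" 0 4, OF _ _ c] by (simp add: continuous_intros)
  then have "Lp_norm \<tau> p (U - (- V)) = G.mean (\<lambda>t. (4 - t) powr (p / 2)) powr (1 / p)"
    using Lp_norm_eq[OF N_diff[OF unitaryD(1)[OF U] unitaryD(1)[OF V']]
        H.spectral_interval_axioms[unfolded gap_def] p]
    unfolding G.mean_def by (simp add: gap_def)
  then show "Lp_norm \<tau> p (U + V) powr p = G.mean (\<lambda>t. (4 - t) powr (p / 2))"
    using powr_cancel[OF G.mean_nonneg[OF c4]] by simp
qed

end

lemma sqrt_powr: "0 \<le> a \<Longrightarrow> sqrt a powr p = a powr (p / 2)"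
  by (simp add: powr_half_sqrt[symmetric] powr_powr)

lemma powr_left_cancel:
  fixes x y p :: real
  assumes "x powr p = y powr p" "0 \<le> x" "0 \<le> y" "p > 0"
  shows "x = y"
  by (metis assms less_irrefl linorder_neqE_linordered_idom powr_less_mono2)

context tracial_algebra
begin

lemma gap_eq_scalar:
  assumes U: "U \<in> unitary_group N" and V: "V \<in> unitary_group N"
    and p: "p > 0" "p \<noteq> 2" and a: "0 \<le> a" "a \<le> 4"
    and Lp: "Lp_norm \<tau> p (U - V) = sqrt a" "Lp_norm \<tau> p (U + V) = sqrt (4 - a)"
  shows "gap U V = a *\<^sub>R id_blinfun"
proof -
  interpret G: tracial_operator N \<tau> "gap U V" 0 4 by (rule tracial_operator_gap[OF U V])
  define q where "q = p / 2"
  have q: "0 < q" "q \<noteq> 1" using p by (auto simp: q_def)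
  have m: "G.mean (\<lambda>t. t powr q) = a powr q" "G.mean (\<lambda>t. (4 - t) powr q) = (4 - a) powr q"
    using Lp_norm_gap[OF U V p(1)] a by (simp_all add: Lp sqrt_powr q_def)
  have c1: "continuous_on {0..4} (\<lambda>t :: real. t powr q)"
    by (intro continuous_on_powr_const continuous_on_id q) simp
  have c2: "continuous_on {0..4} (\<lambda>t :: real. (4 - t) powr q)"
    by (intro continuous_on_powr_const continuous_intros q) simp
  have zero: "fun_calc (\<lambda>t. t - a) (gap U V) = 0"
  proof -
    consider "a = 0" | "a = 4" | "0 < a" "a < 4" using a by linarith
    then show ?thesis
    proof cases
      case 1
      show ?thesis
        by (rule G.fun_calc_eq_0[OF c1]) (use m 1 q in \<open>auto intro: continuous_intros\<close>)
    next
      case 2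
      show ?thesis
        by (rule G.fun_calc_eq_0[OF c2]) (use m 2 q in \<open>auto intro: continuous_intros\<close>)
    next
      case 3
      define h where "h = (\<lambda>t. sgn (q - 1) *
        (a powr (1 - q) * t powr q + (4 - a) powr (1 - q) * (4 - t) powr q - 4))"
      have pos: "0 < h t" if "t \<in> {0..4}" "t \<noteq> a" for t
        unfolding h_def by (rule powr_pair_pos[OF 3 that q])
      have x: "x powr (1 - q) * x powr q = x" if "x > 0" for x :: real
        using that by (simp add: powr_add[symmetric])
      have ha: "h a = 0" using x[of a] x[of "4 - a"] 3 by (simp add: h_def)
      have c1': "continuous_on {0..4} (\<lambda>t. a powr (1 - q) * t powr q)"
        and c2': "continuous_on {0..4} (\<lambda>t. (4 - a) powr (1 - q) * (4 - t) powr q)"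
        by (intro continuous_on_mult continuous_on_const c1 c2)+
      note c12 = continuous_on_add[OF c1' c2']
      note c = continuous_on_diff[OF c12 continuous_on_const[of _ 4]]
      have "G.mean h = h a"
        unfolding h_def G.mean_cmult[OF c] G.mean_diff[OF c12 continuous_on_const]
          G.mean_add[OF c1' c2'] G.mean_cmult[OF c1] G.mean_cmult[OF c2] G.mean_const m ..
      show ?thesis
      proof (rule G.fun_calc_eq_0)
        show "continuous_on {0..4} h"
          unfolding h_def by (intro continuous_on_mult continuous_on_const c)
        show "G.mean h = 0" using \<open>G.mean h = h a\<close> ha by simp
        show "0 \<le> h t" if "t \<in> {0..4}" for t using pos[OF that] ha by fastforce
        show "t - a = 0" if "t \<in> {0..4}" "h t = 0" for t using pos[OF that(1)] that(2) by fastforce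
      qed (intro continuous_intros)
    qed
  qed
  have "fun_calc (\<lambda>t. t - a) (gap U V) = gap U V - a *\<^sub>R id_blinfun"
    by (simp add: G.fun_calc_diff continuous_intros G.fun_calc_const G.fun_calc_ident)
  with zero show ?thesis by simp
qed

lemma Lp_norm_of_gap_scalar:
  assumes U: "U \<in> unitary_group N" and V: "V \<in> unitary_group N"
    and p: "p > 0" and a: "0 \<le> a" "a \<le> 4" and gap: "gap U V = a *\<^sub>R id_blinfun"
  shows "Lp_norm \<tau> p (U - V) = sqrt a" "Lp_norm \<tau> p (U + V) = sqrt (4 - a)"
proof -
  interpret G: tracial_operator N \<tau> "gap U V" 0 4 by (rule tracial_operator_gap[OF U V])
  have "fun_calc (\<lambda>t. t - a) (gap U V) = gap U V - a *\<^sub>R id_blinfun"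
    by (simp add: G.fun_calc_diff continuous_intros G.fun_calc_const G.fun_calc_ident)
  then have ta: "fun_calc (\<lambda>t. t - a) (gap U V) = 0" by (simp only: gap diff_self)
  have c: "continuous_on {0..4} (\<lambda>t. t - a)" by (intro continuous_intros)
  have h: "G.mean (\<lambda>t. (t - a) * (t - a)) = 0"
    unfolding G.mean_square[OF c] ta using trace_scaleR[OF N_zero, of 0] by simp
  have mean: "G.mean f = f a" if f: "continuous_on {0..4} f" for f
  proof -
    have "G.mean (\<lambda>t. f t - f a) = 0"
      by (rule G.mean_eq_0[OF _ _ h]) (auto intro!: continuous_intros f)
    then show ?thesis by (simp add: G.mean_diff[OF f continuous_on_const] G.mean_const)
  qed
  have "Lp_norm \<tau> p (U - V) powr p = sqrt a powr p"
    unfolding Lp_norm_gap[OF U V p] using a p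
    by (subst mean) (auto simp: sqrt_powr intro!: continuous_on_powr_const continuous_on_id)
  then show "Lp_norm \<tau> p (U - V) = sqrt a"
    by (rule powr_left_cancel) (use a p in \<open>auto simp: Lp_norm_def\<close>)
  have c4: "continuous_on {0..4} (\<lambda>t :: real. (4 - t) powr (p / 2))"
    using p by (intro continuous_on_powr_const continuous_intros) auto
  have "Lp_norm \<tau> p (U + V) powr p = sqrt (4 - a) powr p"
    unfolding Lp_norm_gap[OF U V p] using a p mean[OF c4] by (simp add: sqrt_powr)
  then show "Lp_norm \<tau> p (U + V) = sqrt (4 - a)"
    by (rule powr_left_cancel) (use a p in \<open>auto simp: Lp_norm_def\<close>)
qed

lemma antipode_iff:
  assumes U: "U \<in> unitary_group N" and V: "V \<in> unitary_group N" and p: "p > 0"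
  shows "Lp_norm \<tau> p (U - V) = 2 \<longleftrightarrow> V = - U"
proof
  assume Lp: "Lp_norm \<tau> p (U - V) = 2"
  interpret G: tracial_operator N \<tau> "gap U V" 0 4 by (rule tracial_operator_gap[OF U V])
  have c: "continuous_on {0..4} (\<lambda>t :: real. t powr (p / 2))"
    using p by (intro continuous_on_powr_const continuous_on_id) auto
  have "G.mean (\<lambda>t. t powr (p / 2)) = 2 powr p"
    using Lp_norm_gap(1)[OF U V p] Lp by simp
  also have "\<dots> = 4 powr (p / 2)" using sqrt_powr[of 4 p] by simp
  finally have m: "G.mean (\<lambda>t. 4 powr (p / 2) - t powr (p / 2)) = 0"
    by (simp add: G.mean_diff[OF continuous_on_const c] G.mean_const)
  have "fun_calc (\<lambda>t. 4 - t) (gap U V) = 0"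
  proof (rule G.fun_calc_eq_0[OF _ _ m])
    fix t :: real assume t: "t \<in> {0..4}"
    then show "0 \<le> 4 powr (p / 2) - t powr (p / 2)" using p powr_mono2[of "p / 2" t 4] by simp
    assume "4 powr (p / 2) - t powr (p / 2) = 0"
    then have "4 = t" using t p by (intro powr_left_cancel[of 4 "p / 2" t]) auto
    then show "4 - t = 0" by simp
  qed (intro continuous_intros c)+
  then have "gap U (- V) = 0"
    by (simp add: gap_minus[OF U V] G.fun_calc_diff continuous_intros G.fun_calc_const G.fun_calc_ident)
  then have "U - - V = 0" unfolding gap_def
    using trace_scaleR[OF N_zero, of 0]
    by (intro trace_faithful N_diff N_minus unitaryD[OF U] unitaryD[OF V]) simp
  then show "V = - U" by (simp add: add_eq_0_iff)
next
  assume "V = - U"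
  then have "gap U V = 4 *\<^sub>R id_blinfun"
    using gap_minus[OF U U] by (simp add: gap_def)
  from Lp_norm_of_gap_scalar(1)[OF U V p _ _ this] show "Lp_norm \<tau> p (U - V) = 2" by simp
qed

lemma gap_01_iff:
  assumes U: "U \<in> unitary_group N" and V: "V \<in> unitary_group N" and p: "p > 0" "p \<noteq> 2"
  shows "Lp_norm \<tau> p (U - V) powr p + Lp_norm \<tau> p (U + V) powr p = 4 powr (p / 2)
    \<longleftrightarrow> gap U V o\<^sub>L gap U V = 4 *\<^sub>R gap U V"
proof -
  interpret G: tracial_operator N \<tau> "gap U V" 0 4 by (rule tracial_operator_gap[OF U V])
  define q where "q = p / 2"
  have q: "0 < q" "q \<noteq> 1" using p by (auto simp: q_def)
  define h where "h = (\<lambda>t. t powr q + (4 - t) powr q - 4 powr q)"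
  have c1: "continuous_on {0..4} (\<lambda>t :: real. t powr q)"
    by (intro continuous_on_powr_const continuous_on_id q) simp
  have c2: "continuous_on {0..4} (\<lambda>t :: real. (4 - t) powr q)"
    by (intro continuous_on_powr_const continuous_intros q) simp
  have c: "continuous_on {0..4} h" unfolding h_def by (intro continuous_intros c1 c2)
  have ck: "continuous_on {0..4} (\<lambda>t :: real. t * (4 - t))" by (intro continuous_intros)
  have h0: "h t = 0" if "t \<in> {0..4}" "t * (4 - t) = 0" for t using that q by (auto simp: h_def)
  have pos: "0 < sgn (1 - q) * h t" if "t \<in> {0..4}" "t * (4 - t) \<noteq> 0" for t
    unfolding h_def using powr_sum_pos[of t 4 q] that q by auto
  have "fun_calc (\<lambda>t. t * (4 - t)) (gap U V) = 4 *\<^sub>R gap U V - (gap U V o\<^sub>L gap U V)"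
    by (simp add: G.fun_calc_mult G.fun_calc_diff continuous_intros G.fun_calc_const G.fun_calc_ident
        op_ring_simps)
  then have rhs: "gap U V o\<^sub>L gap U V = 4 *\<^sub>R gap U V \<longleftrightarrow> fun_calc (\<lambda>t. t * (4 - t)) (gap U V) = 0"
    by auto
  have "G.mean h = Lp_norm \<tau> p (U - V) powr p + Lp_norm \<tau> p (U + V) powr p - 4 powr q"
    unfolding h_def Lp_norm_gap[OF U V p(1)] q_def[symmetric]
      G.mean_diff[OF continuous_on_add[OF c1 c2] continuous_on_const] G.mean_add[OF c1 c2] G.mean_const ..
  then have "Lp_norm \<tau> p (U - V) powr p + Lp_norm \<tau> p (U + V) powr p = 4 powr (p / 2)
      \<longleftrightarrow> G.mean h = 0" by (auto simp: q_def)
  also have "\<dots> \<longleftrightarrow> fun_calc (\<lambda>t. t * (4 - t)) (gap U V) = 0"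
  proof
    assume "G.mean h = 0"
    then have m: "G.mean (\<lambda>t. sgn (1 - q) * h t) = 0" by (simp add: G.mean_cmult[OF c])
    show "fun_calc (\<lambda>t. t * (4 - t)) (gap U V) = 0"
    proof (rule G.fun_calc_eq_0[OF _ _ m ck])
      show "0 \<le> sgn (1 - q) * h t" if "t \<in> {0..4}" for t using pos[OF that] h0[OF that] by fastforce
      show "t * (4 - t) = 0" if "t \<in> {0..4}" "sgn (1 - q) * h t = 0" for t
        using pos[OF that(1)] that(2) by fastforce
    qed (intro continuous_intros c)
  next
    assume k: "fun_calc (\<lambda>t. t * (4 - t)) (gap U V) = 0"
    have "G.mean (\<lambda>t. t * (4 - t)) = 0"
      unfolding G.mean_def k using trace_scaleR[OF N_zero, of 0] by simp
    from G.mean_eq_0[OF ck _ this c h0] show "G.mean h = 0" by simp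
  qed
  finally show ?thesis by (simp add: rhs)
qed

end

section \<open>Operators commuting with all skew unitaries\<close>

lemma skew_invertible:
  fixes K :: "'h::chilbert_space \<Rightarrow>\<^sub>L 'h"
  assumes K: "K \<in> bounded_ops" "adj K = - K"
  shows "op_invertible (id_blinfun + K)"
proof -
  have below: "norm x \<le> norm (x + blinfun_apply L x)"
    if L: "L \<in> bounded_ops" "adj L = - L" for L :: "'h \<Rightarrow>\<^sub>L 'h" and x
  proof -
    have "Re (cinner x (blinfun_apply L x)) = - Re (cinner (blinfun_apply L x) x)"
      using cinner_adj_right[OF L(1), of x x] by (simp add: L(2) blinfun.minus_left cinner.minus_right)
         (metis minus_complex.sel(1) uminus_complex.sel(1) neg_equal_iff_equal add.inverse_inverse)
    then have "Re (cinner x (blinfun_apply L x)) = 0"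
      using Re_cinner_commute[of x "blinfun_apply L x"] by simp
    then have "(norm x)\<^sup>2 \<le> (norm (x + blinfun_apply L x))\<^sup>2" by (simp add: norm_add_sq)
    then show ?thesis by (rule power2_le_imp_le) simp
  qed
  have adj: "adj (id_blinfun + K) = id_blinfun + - K" using K by (simp add: adj_add adj_id)
  have mK: "- K \<in> bounded_ops" "adj (- K) = - (- K)" using K by (simp_all add: adj_minus)
  show ?thesis
  proof (rule op_invertible_of_bounded_below[where c = 1])
    show "1 * norm x \<le> norm (blinfun_apply (id_blinfun + K) x)" for x
      using below[OF K, of x] by (simp add: blinfun.add_left)
    show "x = 0" if "blinfun_apply (adj (id_blinfun + K)) x = 0" for x
      using below[OF mK, of x] that unfolding adj by (simp add: blinfun.bilinear_simps)
  qed (use K in auto)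
qed

context tracial_algebra
begin

lemma adj_compose_self_eq_0:
  assumes "A \<in> N" "adj A o\<^sub>L A = 0"
  shows "A = 0"
  using assms trace_scaleR[OF N_zero, of 0] by (intro trace_faithful) simp_all

text \<open>The Cayley transform \<open>(1 + K)(1 - K)\<^sup>-\<^sup>1\<close> of a skew operator \<open>K\<close> anticommuting with \<open>J\<close> turns
  \<open>J\<close> into another skew unitary, which commutes with \<open>J\<close> only if \<open>K = 0\<close>.\<close>

lemma anticommuting_skew_eq_0:
  assumes J: "J \<in> unitary_group N" "adj J = - J"
    and comm: "\<And>Q. Q \<in> unitary_group N \<Longrightarrow> adj Q = - Q \<Longrightarrow> Q o\<^sub>L J = J o\<^sub>L Q"
    and K: "K \<in> N" "adj K = - K" and JK: "J o\<^sub>L K = - (K o\<^sub>L J)"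
  shows "K = 0"
proof -
  have KB: "K \<in> bounded_ops" using K by (intro N_bounded_ops)
  have "op_invertible (id_blinfun + K)" by (rule skew_invertible[OF KB K(2)])
  then obtain R where R: "R \<in> bounded_ops" "R o\<^sub>L (id_blinfun + K) = id_blinfun"
    "(id_blinfun + K) o\<^sub>L R = id_blinfun" by (auto simp: op_invertible_def)
  have "op_invertible (id_blinfun + - K)" using KB K(2) by (intro skew_invertible) (auto simp: adj_minus)
  then obtain L where L: "L \<in> bounded_ops" "L o\<^sub>L (id_blinfun - K) = id_blinfun"
    "(id_blinfun - K) o\<^sub>L L = id_blinfun" by (auto simp: op_invertible_def)
  define P M where "P = id_blinfun + K" and "M = id_blinfun - K"
  have PN: "P \<in> N" "M \<in> N" using K by (auto simp: P_def M_def intro: N_closed_under N_diff)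
  have RN: "R \<in> N" "L \<in> N"
    using N_inverse[OF PN(1) R(1)] N_inverse[OF PN(2) L(1)] R L by (auto simp: P_def M_def)
  note RP = R(2,3)[folded P_def] and LM = L(2,3)[folded M_def]
  have JJ: "J o\<^sub>L J = - id_blinfun"
    using unitaryD(4)[OF J(1)] by (simp add: J(2) op_ring_simps minus_equation_iff)
  have PM: "P o\<^sub>L M = M o\<^sub>L P" by (simp add: P_def M_def op_ring_simps)
  have JM: "J o\<^sub>L M = P o\<^sub>L J" and JP: "J o\<^sub>L P = M o\<^sub>L J"
    by (simp_all add: P_def M_def op_ring_simps JK)
  have PL: "P o\<^sub>L L = L o\<^sub>L P"
  proof -
    have "L o\<^sub>L (P o\<^sub>L M) o\<^sub>L L = L o\<^sub>L (M o\<^sub>L P) o\<^sub>L L" by (simp only: PM)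
    then have "(L o\<^sub>L P) o\<^sub>L (M o\<^sub>L L) = (L o\<^sub>L M) o\<^sub>L (P o\<^sub>L L)" by (simp only: blinfun_compose_assoc)
    then show ?thesis by (simp add: LM)
  qed
  have MR: "M o\<^sub>L R = R o\<^sub>L M"
  proof -
    have "R o\<^sub>L (P o\<^sub>L M) o\<^sub>L R = R o\<^sub>L (M o\<^sub>L P) o\<^sub>L R" by (simp only: PM)
    then have "(R o\<^sub>L P) o\<^sub>L (M o\<^sub>L R) = (R o\<^sub>L M) o\<^sub>L (P o\<^sub>L R)" by (simp only: blinfun_compose_assoc)
    then show ?thesis by (simp add: RP)
  qed
  have JL: "J o\<^sub>L L = R o\<^sub>L J"
  proof -
    have "R o\<^sub>L (J o\<^sub>L M) o\<^sub>L L = R o\<^sub>L (P o\<^sub>L J) o\<^sub>L L" by (simp only: JM)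
    then have "(R o\<^sub>L J) o\<^sub>L (M o\<^sub>L L) = (R o\<^sub>L P) o\<^sub>L (J o\<^sub>L L)" by (simp only: blinfun_compose_assoc)
    then show ?thesis by (simp add: RP LM)
  qed
  have adjP: "adj P = M" "adj M = P"
    using KB K(2) by (simp_all add: P_def M_def adj_add adj_diff adj_id)
  have adjL: "adj L = R"
  proof -
    have "adj (M o\<^sub>L L) o\<^sub>L R = R" by (simp add: LM adj_id)
    then have "(adj L o\<^sub>L P) o\<^sub>L R = R" by (simp add: adj_compose N_bounded_ops PN RN adjP)
    then show ?thesis by (simp add: blinfun_compose_assoc RP)
  qed
  define Q where "Q = P o\<^sub>L (L o\<^sub>L J)"
  have QN: "Q \<in> N" unfolding Q_def using PN RN unitaryD(1)[OF J(1)] by (intro N_closed_under)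
  have adjQ: "adj Q = - Q"
  proof -
    have "adj Q = (adj J o\<^sub>L adj L) o\<^sub>L adj P"
      unfolding Q_def using PN RN unitaryD(3)[OF J(1)]
      by (simp add: adj_compose N_bounded_ops)
    also have "\<dots> = - ((J o\<^sub>L R) o\<^sub>L M)" by (simp add: J(2) adjL adjP op_ring_simps)
    also have "(J o\<^sub>L R) o\<^sub>L M = J o\<^sub>L (M o\<^sub>L R)" by (simp only: MR blinfun_compose_assoc)
    also have "\<dots> = P o\<^sub>L (J o\<^sub>L R)" by (metis JM blinfun_compose_assoc)
    also have "J o\<^sub>L R = L o\<^sub>L J"
    proof -
      have "L o\<^sub>L (J o\<^sub>L P) o\<^sub>L R = L o\<^sub>L (M o\<^sub>L J) o\<^sub>L R" by (simp only: JP)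
      then have "(L o\<^sub>L J) o\<^sub>L (P o\<^sub>L R) = (L o\<^sub>L M) o\<^sub>L (J o\<^sub>L R)" by (simp only: blinfun_compose_assoc)
      then show ?thesis by (simp add: RP LM)
    qed
    finally show ?thesis by (simp add: Q_def)
  qed
  have JQ: "J o\<^sub>L Q = - (M o\<^sub>L R)"
  proof -
    have "J o\<^sub>L Q = (J o\<^sub>L P) o\<^sub>L (L o\<^sub>L J)" by (simp only: Q_def blinfun_compose_assoc)
    also have "\<dots> = M o\<^sub>L ((J o\<^sub>L L) o\<^sub>L J)" by (simp only: JP blinfun_compose_assoc)
    also have "\<dots> = M o\<^sub>L (R o\<^sub>L (J o\<^sub>L J))" by (simp only: JL blinfun_compose_assoc)
    finally show ?thesis by (simp add: JJ op_ring_simps)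
  qed
  have QJ: "Q o\<^sub>L J = - (P o\<^sub>L L)"
    by (simp add: Q_def blinfun_compose_assoc JJ op_ring_simps)
  have QQ: "Q o\<^sub>L Q = - id_blinfun"
  proof -
    have "Q o\<^sub>L Q = (P o\<^sub>L L) o\<^sub>L (J o\<^sub>L Q)" by (simp only: Q_def blinfun_compose_assoc)
    also have "\<dots> = - ((P o\<^sub>L L) o\<^sub>L (M o\<^sub>L R))" by (simp add: JQ op_ring_simps)
    also have "(P o\<^sub>L L) o\<^sub>L (M o\<^sub>L R) = P o\<^sub>L ((L o\<^sub>L M) o\<^sub>L R)" by (simp only: blinfun_compose_assoc)
    finally show ?thesis by (simp add: LM RP)
  qed
  have "Q \<in> unitary_group N" using QN QQ by (simp add: unitary_group_def adjQ op_ring_simps)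
  from comm[OF this adjQ] have "P o\<^sub>L L = M o\<^sub>L R" by (simp add: QJ JQ)
  then have "(P o\<^sub>L (P o\<^sub>L L)) o\<^sub>L M = (P o\<^sub>L (M o\<^sub>L R)) o\<^sub>L M" by simp
  then have "(P o\<^sub>L P) o\<^sub>L (L o\<^sub>L M) = (P o\<^sub>L R) o\<^sub>L (M o\<^sub>L M)"
    by (simp only: MR blinfun_compose_assoc)
  then have "P o\<^sub>L P = M o\<^sub>L M" by (simp add: LM RP)
  then have "K + K + (K + K) = 0" by (simp add: P_def M_def op_ring_simps algebra_simps)
  then have "4 *\<^sub>R K = 0" by (simp flip: scaleR_2)
  then show ?thesis by simp
qed

lemma commuting_with_skew_unitaries_central:
  assumes J: "J \<in> unitary_group N" "adj J = - J"
    and comm: "\<And>Q. Q \<in> unitary_group N \<Longrightarrow> adj Q = - Q \<Longrightarrow> Q o\<^sub>L J = J o\<^sub>L Q"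
  shows "J \<in> commutant N"
proof -
  have JJ: "J o\<^sub>L J = - id_blinfun"
    using unitaryD(4)[OF J(1)] by (simp add: J(2) op_ring_simps minus_equation_iff)
  have JJX: "J o\<^sub>L (J o\<^sub>L X) = - X" for X
    by (simp add: JJ op_ring_simps flip: blinfun_compose_assoc)
  have skew: "J o\<^sub>L B = B o\<^sub>L J" if B: "B \<in> N" "adj B = - B" for B
  proof -
    define K where "K = B + (J o\<^sub>L (B o\<^sub>L J))"
    have BJ: "B \<in> bounded_ops" "J \<in> bounded_ops" using B unitaryD(3)[OF J(1)] N_bounded_ops by auto
    have "K \<in> N" unfolding K_def using B unitaryD(1)[OF J(1)] by (intro N_closed_under)
    moreover have "adj K = - K"
      unfolding K_def using BJ B(2) J(2) by (simp add: adj_add adj_compose op_ring_simps)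
    moreover have "J o\<^sub>L K = - (K o\<^sub>L J)"
      by (simp add: K_def op_ring_simps JJX JJ)
    ultimately have "K = 0" by (intro anticommuting_skew_eq_0[OF J]) (use comm in auto)
    then have "J o\<^sub>L K = 0" by simp
    then show ?thesis by (simp add: K_def op_ring_simps JJX)
  qed
  have "J o\<^sub>L A = A o\<^sub>L J" if A: "A \<in> N" for A
  proof -
    have AB: "A \<in> bounded_ops" "J \<in> bounded_ops" using A unitaryD(3)[OF J(1)] N_bounded_ops by auto
    have 1: "J o\<^sub>L (A - adj A) = (A - adj A) o\<^sub>L J"
      by (rule skew) (use A AB in \<open>auto intro: N_diff N_adj simp: adj_diff adj_adj\<close>)
    define B where "B = scalar_op \<i> o\<^sub>L (A + adj A)"
    have "J o\<^sub>L B = B o\<^sub>L J"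
    proof (rule skew)
      show "B \<in> N" unfolding B_def using A by (intro N_closed_under N_adj)
      have "adj B = (A + adj A) o\<^sub>L scalar_op (- \<i>)"
        unfolding B_def using AB by (simp add: adj_compose adj_scalar_op adj_add adj_adj add.commute)
      also have "\<dots> = scalar_op (- \<i>) o\<^sub>L (A + adj A)" using AB by (intro scalar_op_commute) auto
      also have "scalar_op (- \<i>) = - scalar_op \<i>"
        by (rule blinfun_eqI) (simp add: scalar_op_apply blinfun.minus_left
            scaleC_scaleC[of "- 1" "\<i>", simplified, symmetric] scaleC_of_real[of "- 1", simplified])
      finally show "adj B = - B" by (simp add: B_def op_ring_simps)
    qed
    then have "scalar_op (- \<i>) o\<^sub>L (J o\<^sub>L B) = scalar_op (- \<i>) o\<^sub>L (B o\<^sub>L J)" by simp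
    moreover have "scalar_op (- \<i>) o\<^sub>L (J o\<^sub>L B) = J o\<^sub>L (A + adj A)"
    proof -
      have "scalar_op (- \<i>) o\<^sub>L (J o\<^sub>L B) = J o\<^sub>L ((scalar_op (- \<i>) o\<^sub>L scalar_op \<i>) o\<^sub>L (A + adj A))"
        by (simp only: B_def scalar_op_commute[OF AB(2), symmetric] flip: blinfun_compose_assoc)
      then show ?thesis by (simp add: scalar_op_compose scalar_op_1)
    qed
    moreover have "scalar_op (- \<i>) o\<^sub>L (B o\<^sub>L J) = (A + adj A) o\<^sub>L J"
    proof -
      have "scalar_op (- \<i>) o\<^sub>L (B o\<^sub>L J) = ((scalar_op (- \<i>) o\<^sub>L scalar_op \<i>) o\<^sub>L (A + adj A)) o\<^sub>L J"
        by (simp only: B_def blinfun_compose_assoc)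
      then show ?thesis by (simp add: scalar_op_compose scalar_op_1)
    qed
    ultimately have 2: "J o\<^sub>L (A + adj A) = (A + adj A) o\<^sub>L J" by simp
    have "(J o\<^sub>L A) + (J o\<^sub>L A) = (A o\<^sub>L J) + (A o\<^sub>L J)"
      using arg_cong2[OF 1 2, of "(+)"] by (simp add: op_ring_simps)
    then have "2 *\<^sub>R (J o\<^sub>L A) = 2 *\<^sub>R (A o\<^sub>L J)" by (simp only: scaleR_2)
    then show ?thesis by simp
  qed
  then show ?thesis using unitaryD(3)[OF J(1)] by (simp add: commutant_def)
qed

end

lemma scalar_op_minus: "scalar_op (- c) = - scalar_op c"
proof -
  have "scalar_op (- c) = scalar_op (complex_of_real (- 1)) o\<^sub>L scalar_op c"
    by (simp add: scalar_op_compose)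
  then show ?thesis by (simp only: scalar_op_of_real) (simp add: op_ring_simps)
qed

lemma scaleR_scalar_op: "r *\<^sub>R scalar_op c = scalar_op (complex_of_real r * c)"
  using scalar_op_compose[of "complex_of_real r" c] by (simp add: scalar_op_of_real op_ring_simps)

lemma scalar_op_eq_iff:
  assumes "(id_blinfun :: 'h::chilbert_space \<Rightarrow>\<^sub>L 'h) \<noteq> 0"
  shows "scalar_op c = (scalar_op d :: 'h \<Rightarrow>\<^sub>L 'h) \<longleftrightarrow> c = d"
proof
  assume eq: "scalar_op c = (scalar_op d :: 'h \<Rightarrow>\<^sub>L 'h)"
  obtain x :: 'h where x: "x \<noteq> 0"
    using assms by (metis blinfun_eqI blinfun_apply_id_blinfun zero_blinfun.rep_eq)
  have "c *\<^sub>C x = d *\<^sub>C x" using eq by (metis scalar_op_apply)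
  then have "c * cinner x x = d * cinner x x" by (metis cinner_scaleC_right)
  then show "c = d" using x by (simp add: cinner_self)
qed simp

context tracial_algebra
begin

lemma scalar_unitary: "cmod z = 1 \<Longrightarrow> scalar_op z \<in> unitary_group N"
  by (simp add: unitary_group_def N_closed_under adj_scalar_op scalar_op_compose
      complex_norm_square[symmetric] mult.commute scalar_op_1)

lemma unitary_skew_square:
  assumes "Q \<in> unitary_group N" "adj Q = - Q"
  shows "Q o\<^sub>L Q = - id_blinfun"
  using unitaryD(4)[OF assms(1)] by (simp add: assms(2) op_ring_simps minus_equation_iff)

lemma gap_eq_iff:
  assumes "U \<in> unitary_group N" "V \<in> unitary_group N"
  shows "gap U V = (2 - c) *\<^sub>R id_blinfun \<longleftrightarrow> (adj U o\<^sub>L V) + (adj V o\<^sub>L U) = c *\<^sub>R id_blinfun"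
proof -
  have "A - X = A - Y \<longleftrightarrow> X = Y" for A X Y :: "'h \<Rightarrow>\<^sub>L 'h" by auto
  then show ?thesis by (simp only: gap_eq[OF assms] scaleR_diff_left)
qed

lemma skew_unitaries_commute_iff:
  assumes U: "U \<in> unitary_group N" "adj U = - U" and V: "V \<in> unitary_group N" "adj V = - V"
  shows "gap U V o\<^sub>L gap U V = 4 *\<^sub>R gap U V \<longleftrightarrow> U o\<^sub>L V = V o\<^sub>L U"
proof -
  have UU: "U o\<^sub>L U = - id_blinfun" "U o\<^sub>L (U o\<^sub>L X) = - X" for X
    using unitary_skew_square[OF U] by (simp_all add: op_ring_simps flip: blinfun_compose_assoc)
  have VV: "V o\<^sub>L V = - id_blinfun" "V o\<^sub>L (V o\<^sub>L X) = - X" for X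
    using unitary_skew_square[OF V] by (simp_all add: op_ring_simps flip: blinfun_compose_assoc)
  define D where "D = (U o\<^sub>L V) - (V o\<^sub>L U)"
  have gap: "gap U V = id_blinfun + id_blinfun + ((U o\<^sub>L V) + (V o\<^sub>L U))"
    by (simp add: gap_eq U V op_ring_simps scaleR_2)
  have "4 *\<^sub>R gap U V = (gap U V + gap U V) + (gap U V + gap U V)"
    by (simp flip: scaleR_2)
  then have "4 *\<^sub>R gap U V - (gap U V o\<^sub>L gap U V) = - (D o\<^sub>L D)"
    by (simp add: gap D_def op_ring_simps UU VV)
  moreover have adjD: "adj D = - D"
    using unitaryD(3)[OF U(1)] unitaryD(3)[OF V(1)]
    by (simp add: D_def adj_diff adj_compose U V op_ring_simps)
  have "D = 0" if "D o\<^sub>L D = 0"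
  proof (rule adj_compose_self_eq_0)
    show "D \<in> N" unfolding D_def by (intro N_diff N_closed_under unitaryD[OF U(1)] unitaryD[OF V(1)])
    show "adj D o\<^sub>L D = 0" using that by (simp add: adjD op_ring_simps)
  qed
  ultimately have "gap U V o\<^sub>L gap U V = 4 *\<^sub>R gap U V \<longleftrightarrow> D = 0" by auto
  then show ?thesis by (simp add: D_def)
qed

lemma cross_transfer:
  assumes U: "U \<in> unitary_group N" and V: "V \<in> unitary_group N"
    and U': "U' \<in> unitary_group N" and V': "V' \<in> unitary_group N"
    and p: "p > 0" "p \<noteq> 2" and c: "-2 \<le> c" "c \<le> 2"
    and Lp: "Lp_norm \<tau> p (U' - V') = Lp_norm \<tau> p (U - V)"
      "Lp_norm \<tau> p (U' + V') = Lp_norm \<tau> p (U + V)"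
    and cross: "(adj U o\<^sub>L V) + (adj V o\<^sub>L U) = c *\<^sub>R id_blinfun"
  shows "(adj U' o\<^sub>L V') + (adj V' o\<^sub>L U') = c *\<^sub>R id_blinfun"
proof -
  have "gap U V = (2 - c) *\<^sub>R id_blinfun" using cross by (simp only: gap_eq_iff[OF U V])
  from Lp_norm_of_gap_scalar[OF U V p(1) _ _ this] c
  have "Lp_norm \<tau> p (U' - V') = sqrt (2 - c)" "Lp_norm \<tau> p (U' + V') = sqrt (4 - (2 - c))"
    by (simp_all add: Lp)
  from gap_eq_scalar[OF U' V' p _ _ this] c have "gap U' V' = (2 - c) *\<^sub>R id_blinfun" by simp
  then show ?thesis by (simp only: gap_eq_iff[OF U' V'])
qed

end

theorem lemma2p6:
  fixes N :: "('h::chilbert_space \<Rightarrow>\<^sub>L 'h) set"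
    and \<tau> :: "('h \<Rightarrow>\<^sub>L 'h) \<Rightarrow> complex"
    and p :: real
    and \<psi> :: "('h \<Rightarrow>\<^sub>L 'h) \<Rightarrow> ('h \<Rightarrow>\<^sub>L 'h)"
  assumes "0 < p" and "p \<noteq> 2"
    and "II1_factor N"
    and "faithful_tracial_state N \<tau>"
    and "Lp_isometry \<tau> p N \<psi>"
    and "\<psi> ` unitary_group N = unitary_group N"
    and "\<psi> id_blinfun = id_blinfun"
  shows "(\<forall>\<theta>::real. \<psi> (scalar_op (exp (\<i> * complex_of_real \<theta>))) = scalar_op (exp (\<i> * complex_of_real \<theta>))) \<or>
         (\<forall>\<theta>::real. \<psi> (scalar_op (exp (\<i> * complex_of_real \<theta>))) = scalar_op (exp (- \<i> * complex_of_real \<theta>)))"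
proof -
  note p = \<open>0 < p\<close> \<open>p \<noteq> 2\<close>
  have "factor N" using \<open>II1_factor N\<close> by (simp add: II1_factor_def)
  then have vN: "von_neumann_algebra N" and nt: "(id_blinfun :: 'h \<Rightarrow>\<^sub>L 'h) \<noteq> 0"
    and center: "N \<inter> commutant N = range scalar_op"
    by (auto simp: factor_def)
  interpret tracial_algebra N \<tau> using vN nt \<open>faithful_tracial_state N \<tau>\<close> by unfold_locales
  let ?G = "unitary_group N"
  have \<psi>G: "\<psi> U \<in> ?G" if "U \<in> ?G" for U using that \<open>\<psi> ` ?G = ?G\<close> by blast
  have iso: "Lp_norm \<tau> p (\<psi> U - \<psi> V) = Lp_norm \<tau> p (U - V)" if "U \<in> ?G" "V \<in> ?G" for U V
    using that \<open>Lp_isometry \<tau> p N \<psi>\<close> by (simp add: Lp_isometry_def)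
  have neg: "\<psi> (- U) = - \<psi> U" if U: "U \<in> ?G" for U
  proof -
    have "Lp_norm \<tau> p (U - (- U)) = 2" using antipode_iff[OF U unitary_minus[OF U] p(1)] by simp
    then have "Lp_norm \<tau> p (\<psi> U - \<psi> (- U)) = 2" using iso[OF U unitary_minus[OF U]] by simp
    then show ?thesis using antipode_iff[OF \<psi>G[OF U] \<psi>G[OF unitary_minus[OF U]] p(1)] by simp
  qed
  have iso': "Lp_norm \<tau> p (\<psi> U + \<psi> V) = Lp_norm \<tau> p (U + V)" if UV: "U \<in> ?G" "V \<in> ?G" for U V
    using iso[OF UV(1) unitary_minus[OF UV(2)]] by (simp add: neg[OF UV(2)])
  have cross: "(adj (\<psi> U) o\<^sub>L \<psi> V) + (adj (\<psi> V) o\<^sub>L \<psi> U) = c *\<^sub>R id_blinfun \<longleftrightarrow>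
      (adj U o\<^sub>L V) + (adj V o\<^sub>L U) = c *\<^sub>R id_blinfun"
    if UV: "U \<in> ?G" "V \<in> ?G" and c: "-2 \<le> c" "c \<le> 2" for U V c
    using cross_transfer[OF UV \<psi>G[OF UV(1)] \<psi>G[OF UV(2)] p c iso[OF UV] iso'[OF UV]]
      cross_transfer[OF \<psi>G[OF UV(1)] \<psi>G[OF UV(2)] UV p c iso[OF UV, symmetric] iso'[OF UV, symmetric]]
    by blast
  have id: "id_blinfun \<in> ?G" using scalar_unitary[of 1] by (simp add: scalar_op_1)
  have skew_iff: "adj (\<psi> V) = - \<psi> V \<longleftrightarrow> adj V = - V" if V: "V \<in> ?G" for V
    using cross[OF id V, of 0] by (simp add: \<open>\<psi> id_blinfun = id_blinfun\<close> adj_id add_eq_0_iff)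

  let ?I = "scalar_op \<i> :: 'h \<Rightarrow>\<^sub>L 'h"
  have I: "?I \<in> ?G" "adj ?I = - ?I" by (simp_all add: scalar_unitary adj_scalar_op scalar_op_minus)
  define J where "J = \<psi> ?I"
  have J: "J \<in> ?G" "adj J = - J" using \<psi>G[OF I(1)] skew_iff[OF I(1)] I(2) by (simp_all add: J_def)
  have "J \<in> commutant N"
  proof (rule commuting_with_skew_unitaries_central[OF J])
    fix Q' assume Q': "Q' \<in> ?G" "adj Q' = - Q'"
    then obtain Q where Q: "Q \<in> ?G" "Q' = \<psi> Q" using \<open>\<psi> ` ?G = ?G\<close> by blast
    then have skewQ: "adj Q = - Q" using Q'(2) skew_iff by simp
    have "Q o\<^sub>L ?I = ?I o\<^sub>L Q" by (intro scalar_op_commute unitaryD(3)[OF Q(1)])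
    then have "Lp_norm \<tau> p (Q - ?I) powr p + Lp_norm \<tau> p (Q + ?I) powr p = 4 powr (p / 2)"
      by (simp only: gap_01_iff[OF Q(1) I(1) p] skew_unitaries_commute_iff[OF Q(1) skewQ I])
    then have "Lp_norm \<tau> p (Q' - J) powr p + Lp_norm \<tau> p (Q' + J) powr p = 4 powr (p / 2)"
      by (simp only: Q(2) J_def iso[OF Q(1) I(1)] iso'[OF Q(1) I(1)])
    then show "Q' o\<^sub>L J = J o\<^sub>L Q'"
      by (simp only: gap_01_iff[OF Q'(1) J(1) p] skew_unitaries_commute_iff[OF Q' J])
  qed
  then obtain c where c: "J = scalar_op c" using unitaryD(1)[OF J(1)] center by blast
  have "c * c = -1"
    using unitary_skew_square[OF J] nt
    by (simp add: c scalar_op_compose scalar_op_eq_iff scalar_op_minus[symmetric] flip: scalar_op_1)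
  then have "(c - \<i>) * (c + \<i>) = 0" by (simp add: algebra_simps)
  then have "c = \<i> \<or> c = - \<i>" by (simp add: eq_neg_iff_add_eq_0)
  then have "\<exists>s :: real. (s = 1 \<or> s = -1) \<and> c = complex_of_real s * \<i>"
    by (elim disjE) (rule exI[of _ 1], simp, rule exI[of _ "-1"], simp)
  then obtain s :: real where s: "s = 1 \<or> s = -1" "c = complex_of_real s * \<i>" by blast

  have W: "\<psi> (scalar_op (exp (\<i> * complex_of_real \<theta>))) = scalar_op (exp (\<i> * complex_of_real (s * \<theta>)))"
    for \<theta>
  proof -
    define z where "z = exp (\<i> * complex_of_real \<theta>)"
    have z: "cmod z = 1" "z = complex_of_real (cos \<theta>) + \<i> * complex_of_real (sin \<theta>)"
      by (simp add: z_def) (simp add: z_def exp_Euler cos_of_real sin_of_real)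
    have Z: "scalar_op z \<in> ?G" using z(1) by (rule scalar_unitary)
    define W where "W = \<psi> (scalar_op z)"
    have WB: "W \<in> bounded_ops" using unitaryD(3)[OF \<psi>G[OF Z]] by (simp add: W_def)
    have two: "\<bar>2 * cos \<theta>\<bar> \<le> 2" "\<bar>2 * sin \<theta>\<bar> \<le> 2" by (simp_all add: abs_mult)
    have "scalar_op z + adj (scalar_op z) = (2 * cos \<theta>) *\<^sub>R (id_blinfun :: 'h \<Rightarrow>\<^sub>L 'h)"
      by (simp add: adj_scalar_op scalar_op_add scalar_op_of_real[symmetric] z(2))
    then have 1: "W + adj W = (2 * cos \<theta>) *\<^sub>R id_blinfun"
      using cross[OF id Z, of "2 * cos \<theta>"] two
      by (simp add: \<open>\<psi> id_blinfun = id_blinfun\<close> adj_id W_def)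
    have "(adj ?I o\<^sub>L scalar_op z) + (adj (scalar_op z) o\<^sub>L ?I) = (2 * sin \<theta>) *\<^sub>R id_blinfun"
      by (simp add: adj_scalar_op scalar_op_compose scalar_op_add scalar_op_of_real[symmetric] z(2)
          algebra_simps)
    then have "(adj J o\<^sub>L W) + (adj W o\<^sub>L J) = (2 * sin \<theta>) *\<^sub>R id_blinfun"
      using cross[OF I(1) Z, of "2 * sin \<theta>"] two by (simp add: W_def J_def)
    then have "scalar_op c o\<^sub>L (adj W - W) = (2 * sin \<theta>) *\<^sub>R id_blinfun"
      using J(2) WB by (simp add: c op_ring_simps scalar_op_commute[symmetric])
    then have "scalar_op c o\<^sub>L (scalar_op c o\<^sub>L (adj W - W)) = scalar_op c o\<^sub>L ((2 * sin \<theta>) *\<^sub>R id_blinfun)"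
      by simp
    then have 2: "W - adj W = (2 * sin \<theta>) *\<^sub>R scalar_op c"
      using \<open>c * c = -1\<close>
      by (simp add: scalar_op_compose scalar_op_minus scalar_op_1 op_ring_simps
          flip: blinfun_compose_assoc)
    have "2 *\<^sub>R W = (W + adj W) + (W - adj W)" by (simp add: scaleR_2)
    also have "\<dots> = 2 *\<^sub>R scalar_op (complex_of_real (cos \<theta>) + complex_of_real (sin \<theta>) * c)"
      unfolding 1 2 by (simp add: scalar_op_of_real[symmetric] scaleR_scalar_op scalar_op_add algebra_simps)
    finally have "W = scalar_op (complex_of_real (cos \<theta>) + complex_of_real (sin \<theta>) * c)" by simp
    also have "complex_of_real (cos \<theta>) + complex_of_real (sin \<theta>) * c = exp (\<i> * complex_of_real (s * \<theta>))"
      using s by (auto simp: exp_Euler cos_of_real sin_of_real)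
    finally show ?thesis by (simp only: W_def z_def)
  qed
  from s(1) show ?thesis
  proof
    assume "s = 1"
    then show ?thesis using W by simp
  next
    assume "s = -1"
    then show ?thesis using W by simp
  qed
qed

end
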